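(* Let $\eta\geq 1$ be a fixed integer and $f=X^{2^\eta}+1$. For integers $N\geq1$ put $\ell_f(N)=\operatorname{rad}\operatorname{lcm}\{f(1),\ldots,f(N)\}$ (the product of the distinct primes dividing $f(1)\cdots f(N)$). Then there is a constant $C_\eta>0$ depending only on $\eta$ such that for all integers $N\geq 2$, \[ \log \ell_f(N)\;\geq\;\frac{2^\eta-1}{\eta\, 2^{\eta-1}}\,N\log N - C_\eta N . \]
   Context: $\operatorname{rad}(m)$ denotes the product of the distinct primes dividing the nonzero integer $m$. *)

theory Defs
  imports Complex_Main "HOL-Computational_Algebra.Computational_Algebra"
begin

text \<open>The elements of \<^term>\<open>prime_factors (m :: int)\<close> are the positive primes dividing \<^term>\<open>m\<close>;
  the definition is meant for nonzero \<^term>\<open>m\<close> only.\<close>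

definition rad :: "int \<Rightarrow> int" where
  "rad m = \<Prod>(prime_factors m)"

definition ell :: "int poly \<Rightarrow> nat \<Rightarrow> int" where
  "ell f N = rad (Lcm ((\<lambda>n. poly f (int n)) ` {1..N}))"

end

(* Write d = 2^eta. On the one hand, the logarithm of f(1) ... f(N) is at least d N log N - d N.
   On the other hand it is the sum of v_p log p over the primes p dividing this product.

   Primes p <= 2N: p^e divides at most d (N / p^e + 1) of the values, so their contribution is at most
   d N times the sum of (log p) / p over the odd primes p dividing some value, up to O(N). For this sum
   only the upper bound log x / d + O(1) is needed, so no non-vanishing of L(1, chi) enters. Modulo such
   p, x^d + 1 has d roots r, and for every r the difference of two vectors in {0..<M}^d, read as a polynomial
   of degree < d, vanishes at r modulo p for at least the proportion 1/p of all pairs. Hence the norms from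
   the 2d-th cyclotomic field of these differences, which are O(M^d), have on average at least
   d (sum of (log p) / p) - O(1) as logarithm, where p runs up to M^d.

   Primes p > 2N: if e >= 2^i, then the 2^(i+1)-th powers of the n <= N with p^e | f(n) are
   incongruent modulo p^e, and their 2^j-th powers are -1, where i + 1 + j = eta; so there are at most 2^j
   such n. Summing over e gives v_p <= eta 2^(eta-1). *)

theory Submission
  imports Defs "HOL-Analysis.Convex" "HOL-Number_Theory.Cong"
begin

section \<open>Chebyshev bounds\<close>

lemma prod_primes_dvd_nat:
  fixes n :: nat
  assumes "finite S" "\<And>p. p \<in> S \<Longrightarrow> prime p" "\<And>p. p \<in> S \<Longrightarrow> p dvd n"
  shows "\<Prod>S dvd n"
  using assms
proof (induction S rule: finite_induct)
  case (insert p S)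
  have "coprime p (\<Prod>S)"
    using insert by (intro prod_coprime_right) (metis insertCI primes_coprime)
  with insert show ?case by (simp add: divides_mult)
qed auto

text \<open>Each of these primes divides \<open>fact (2 * m + 1)\<close> but, exceeding
  \<open>m + 1\<close>, neither \<open>fact m\<close> nor \<open>fact (m + 1)\<close>, so it
  survives in the binomial coefficient.\<close>

lemma prod_primes_interval_dvd_binomial:
  "\<Prod>{p. prime p \<and> m + 1 < p \<and> p \<le> 2 * m + 1} dvd (2 * m + 1 choose m)"
proof (rule prod_primes_dvd_nat)
  fix p assume "p \<in> {p. prime p \<and> m + 1 < p \<and> p \<le> 2 * m + 1}"
  then have p: "prime p" "m + 1 < p" "p \<le> 2 * m + 1" by auto
  have "p dvd (fact (2 * m + 1) :: nat)"
    using p by (simp only: prime_dvd_fact_iff)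
  also have "fact (2 * m + 1) = fact m * fact (m + 1) * (2 * m + 1 choose m)"
    using binomial_fact_lemma[of m "2 * m + 1"] by (simp add: mult_2)
  finally show "p dvd (2 * m + 1 choose m)"
    using p by (simp only: prime_dvd_mult_iff prime_dvd_fact_iff) auto
qed auto

text \<open>Erdos's induction. An even \<open>n > 2\<close> brings no new prime. For
  \<open>n = 2 * m + 1\<close> the primes above \<open>m + 1\<close> divide a middle binomial
  coefficient, which is at most half the row sum, that is \<open>4 ^ m\<close>, and the rest is the
  case \<open>m + 1\<close>.\<close>

lemma prod_primes_le: "\<Prod>{p::nat. prime p \<and> p \<le> n} \<le> 4 ^ n"
proof (induction n rule: less_induct)
  case (less n)
  have "n \<le> 2 \<or> n > 2 \<and> even n \<or> (\<exists>m>0. n = 2 * m + 1)" by presburger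
  then consider "n \<le> 2" | "n > 2" "even n" | m where "n = 2 * m + 1" "m > 0"
    by blast
  then show ?case
  proof cases
    case 1
    then have "n = 0 \<or> n = 1 \<or> n = 2" by auto
    moreover have "{p::nat. prime p \<and> p \<le> n} = (if n = 2 then {2} else {})"
      using 1 by (auto dest!: prime_ge_2_nat)
    ultimately show ?thesis by auto
  next
    case 2
    have "{p. prime p \<and> p \<le> n} = {p. prime p \<and> p \<le> n - 1}"
    proof (intro Collect_cong conj_cong refl)
      fix p :: nat assume "prime p"
      then have "p \<noteq> n" using 2 prime_odd_nat[of p] by auto
      then show "p \<le> n \<longleftrightarrow> p \<le> n - 1" by auto
    qed
    then have "\<Prod>{p::nat. prime p \<and> p \<le> n} \<le> 4 ^ (n - 1)"
      using less.IH[of "n - 1"] 2 by auto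
    also have "\<dots> \<le> 4 ^ n" by (intro power_increasing) auto
    finally show ?thesis .
  next
    case 3
    have split: "{p. prime p \<and> p \<le> n} = {p. prime p \<and> p \<le> m + 1} \<union> {p. prime p \<and> m + 1 < p \<and> p \<le> 2 * m + 1}"
      using 3 by auto
    have "\<Prod>{p. prime p \<and> m + 1 < p \<and> p \<le> 2 * m + 1} \<le> (2 * m + 1 choose m)"
      by (intro dvd_imp_le prod_primes_interval_dvd_binomial) auto
    also have "\<dots> \<le> (\<Sum>k\<le>m. 2 * m + 1 choose k)"
      by (rule member_le_sum) auto
    also have "\<dots> = 4 ^ m"
      using binomial_r_part_sum[of m] by (simp add: power_mult)
    finally have *: "\<Prod>{p. prime p \<and> m + 1 < p \<and> p \<le> 2 * m + 1} \<le> 4 ^ m" .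
    have "\<Prod>{p. prime p \<and> p \<le> n} = \<Prod>{p. prime p \<and> p \<le> m + 1} * \<Prod>{p. prime p \<and> m + 1 < p \<and> p \<le> 2 * m + 1}"
      unfolding split by (rule prod.union_disjoint) auto
    also have "\<dots> \<le> 4 ^ (m + 1) * 4 ^ m"
      using 3 by (intro mult_mono * less.IH) auto
    also have "\<dots> = 4 ^ n" using 3 by (simp add: power_add mult_2)
    finally show ?thesis .
  qed
qed

lemma sum_ln_primes_le: "(\<Sum>p | prime p \<and> p \<le> n. ln (real p)) \<le> real n * ln 4"
proof -
  have pos: "0 < real p" if "p \<in> {p. prime p \<and> p \<le> n}" for p
    using that by (auto simp: prime_gt_0_nat)
  have "(\<Sum>p | prime p \<and> p \<le> n. ln (real p)) = ln (\<Prod>p | prime p \<and> p \<le> n. real p)"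
    by (rule ln_prod[symmetric]) (use pos in auto)
  also have "\<dots> \<le> ln (4 ^ n)"
  proof (subst ln_le_cancel_iff)
    show "0 < (\<Prod>p | prime p \<and> p \<le> n. real p)" by (rule prod_pos) (use pos in auto)
    have "(\<Prod>p | prime p \<and> p \<le> n. real p) = real (\<Prod>{p. prime p \<and> p \<le> n})" by simp
    also have "\<dots> \<le> real (4 ^ n)" using prod_primes_le[of n] by (rule of_nat_mono)
    finally show "(\<Prod>p | prime p \<and> p \<le> n. real p) \<le> 4 ^ n" by simp
  qed auto
  also have "\<dots> = real n * ln 4" by (simp add: ln_realpow)
  finally show ?thesis .
qed

text \<open>There are at most sqrt n primes up to sqrt n, and ln n is at most 2 sqrt n. Beyond sqrt
  n one has ln n \<le> 2 ln p, so the count reduces to the sum of ln p.\<close>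

lemma card_primes_mult_ln_le:
  assumes "n \<ge> 1"
  shows "real (card {p::nat. prime p \<and> p \<le> n}) * ln (real n) \<le> (2 + 2 * ln 4) * real n"
proof -
  let ?P = "{p::nat. prime p \<and> p \<le> n}"
  define S where "S = {p\<in>?P. real p \<le> sqrt (real n)}"
  define L where "L = {p\<in>?P. real p > sqrt (real n)}"
  have fin: "finite S" "finite L" unfolding S_def L_def by auto
  have "?P = S \<union> L" "S \<inter> L = {}" unfolding S_def L_def by auto
  then have card: "card ?P = card S + card L" using fin by (simp add: card_Un_disjoint)
  have n1: "sqrt (real n) \<ge> 1" "ln (real n) \<ge> 0" using assms by auto
  have lnsqrt: "ln (real n) = 2 * ln (sqrt (real n))" using assms by (simp add: ln_sqrt)
  have "S \<subseteq> {1..nat \<lfloor>sqrt (real n)\<rfloor>}"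
    unfolding S_def by (auto simp: le_nat_floor dest: prime_gt_0_nat)
  then have "card S \<le> nat \<lfloor>sqrt (real n)\<rfloor>" using card_mono[of "{1..nat \<lfloor>sqrt (real n)\<rfloor>}" S] by simp
  then have S: "real (card S) \<le> sqrt (real n)" using n1 by linarith
  have "real (card S) * ln (real n) \<le> sqrt (real n) * (2 * sqrt (real n))"
  proof (intro mult_mono S)
    have "ln (sqrt (real n)) \<le> sqrt (real n)" using n1 by (intro ln_bound) auto
    then show "ln (real n) \<le> 2 * sqrt (real n)" using lnsqrt by simp
  qed (use n1 in auto)
  also have "\<dots> = 2 * real n" by simp
  finally have 1: "real (card S) * ln (real n) \<le> 2 * real n" .
  have nonneg: "0 \<le> ln (real p)" if "p \<in> ?P" for p
    using that prime_ge_1_nat[of p] by auto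
  have "real (card L) * ln (real n) = (\<Sum>p\<in>L. ln (real n))" by simp
  also have "\<dots> \<le> (\<Sum>p\<in>L. 2 * ln (real p))"
  proof (rule sum_mono)
    fix p assume "p \<in> L"
    then have "ln (sqrt (real n)) \<le> ln (real p)"
      using n1 unfolding L_def by (intro ln_mono) auto
    then show "ln (real n) \<le> 2 * ln (real p)" using lnsqrt by simp
  qed
  also have "\<dots> \<le> (\<Sum>p\<in>?P. 2 * ln (real p))"
  proof (rule sum_mono2)
    show "0 \<le> 2 * ln (real p)" if "p \<in> ?P - L" for p
      using nonneg[of p] that by (simp del: ln_ge_zero_iff)
  qed (auto simp: L_def)
  also have "\<dots> = 2 * (\<Sum>p\<in>?P. ln (real p))" by (simp add: sum_distrib_left)
  also have "\<dots> \<le> 2 * (real n * ln 4)" using sum_ln_primes_le[of n] by simp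
  finally show ?thesis using 1 card by (simp add: algebra_simps)
qed

lemma sum_ln_div_le: "(\<Sum>n=2..X. ln (real n) / (real n * (real n - 1))) \<le> 2"
proof -
  \<comment> \<open>The terms are dominated by differences of \<open>h\<close>. The shift by 2 is
    what the telescoping inequality needs: it reduces to x (ln x - ln (x - 1)) \<le> 2, which
    follows from x / (x - 1) \<le> 2. The final bound is \<open>h 1 = 2\<close>.\<close>
  define h where "h n = (ln (real n) + 2) / real n" for n
  have telescope: "ln (real n) / (real n * (real n - 1)) \<le> h (n - 1) - h n" if "n \<ge> 2" for n
  proof -
    define x where "x = real n"
    have x: "x \<ge> 2" using that x_def by simp
    have "ln x - ln (x - 1) = ln (x / (x - 1))" using x by (simp add: ln_div)
    also have "\<dots> \<le> x / (x - 1) - 1" using x by (intro ln_le_minus_one) auto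
    also have "\<dots> = 1 / (x - 1)" using x by (simp add: field_simps)
    finally have "x * (ln x - ln (x - 1)) \<le> x * (1 / (x - 1))" using x by (intro mult_left_mono) auto
    also have "\<dots> \<le> 2" using x by (simp add: field_simps)
    finally have "ln x \<le> x * (ln (x - 1) + 2) - (x - 1) * (ln x + 2)" by (simp add: algebra_simps)
    then have "ln x / (x * (x - 1)) \<le> (x * (ln (x - 1) + 2) - (x - 1) * (ln x + 2)) / (x * (x - 1))"
      using x by (intro divide_right_mono) auto
    also have "\<dots> = (ln (x - 1) + 2) / (x - 1) - (ln x + 2) / x" using x by (simp add: field_simps)
    also have "\<dots> = h (n - 1) - h n" using that by (simp add: h_def x_def of_nat_diff)
    finally show ?thesis by (simp add: x_def)
  qed
  have "(\<Sum>n=2..X. ln (real n) / (real n * (real n - 1))) \<le> 2 - h X" if "X \<ge> 1" for X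
    using that
  proof (induction X rule: dec_induct)
    case base then show ?case by (simp add: h_def)
  next
    case (step X)
    then show ?case using telescope[of "Suc X"] by simp
  qed
  moreover have "h X \<ge> 0" if "X \<ge> 1" using that by (simp add: h_def)
  ultimately show ?thesis by (cases "X \<ge> 1") force+
qed

section \<open>Prime powers dividing values\<close>

lemma card_le_mult_card_image:
  assumes "finite A" "\<And>y. y \<in> g ` A \<Longrightarrow> card {x \<in> A. g x = y} \<le> k"
  shows "card A \<le> k * card (g ` A)"
proof -
  have "card A = (\<Sum>y\<in>g ` A. card {x \<in> A. g x = y})"
    using sum.image_gen[OF assms(1), of "\<lambda>_. 1::nat" g] by simp
  also have "\<dots> \<le> (\<Sum>y\<in>g ` A. k)" by (rule sum_mono) (rule assms(2))
  finally show ?thesis by (simp add: mult.commute)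
qed

lemma prime_power_dvd_mult_cases:
  fixes p :: int
  assumes "prime p" "p ^ e dvd a * b" "\<not> (p dvd a \<and> p dvd b)"
  shows "p ^ e dvd a \<or> p ^ e dvd b"
proof (cases "p dvd a")
  case True
  then have "coprime (p ^ e) b" using assms by (simp add: prime_imp_coprime)
  then show ?thesis using assms(2) by (simp add: coprime_dvd_mult_left_iff)
next
  case False
  then have "coprime (p ^ e) a" using assms by (simp add: prime_imp_coprime)
  then show ?thesis using assms(2) by (simp add: coprime_dvd_mult_right_iff)
qed

text \<open>If \<open>p\<close> divided both factors of (x - y) (x + y), it would divide their sum 2
  x. So the whole power of \<open>p\<close> lies in a single factor.\<close>

lemma prime_power_dvd_diff_squares:
  fixes x y :: int
  assumes "prime p" "odd p" "\<not> p dvd x" "p ^ e dvd x\<^sup>2 - y\<^sup>2"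
  shows "p ^ e dvd x - y \<or> p ^ e dvd x + y"
proof (rule prime_power_dvd_mult_cases)
  show "p ^ e dvd (x - y) * (x + y)" using assms(4) by (simp add: power2_eq_square algebra_simps)
  show "\<not> (p dvd x - y \<and> p dvd x + y)"
  proof
    assume "p dvd x - y \<and> p dvd x + y"
    then have "p dvd (x - y) + (x + y)" by (elim conjE) (rule dvd_add)
    also have "(x - y) + (x + y) = 2 * x" by simp
    finally have "p dvd 2 * x" .
    moreover have "\<not> p dvd 2"
      using assms(1,2) primes_dvd_imp_eq[of p 2] by auto
    ultimately show False using assms by (simp add: prime_dvd_mult_iff)
  qed
qed fact

text \<open>Squaring is at most two-to-one on residues prime to \<open>p\<close>, and
  \<open>j\<close> squarings send all of them to the class of \<open>c\<close>. Residue classes are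
  counted, since distinct members of \<open>S\<close> may be congruent.\<close>

lemma card_roots_2power_le:
  fixes p c :: int
  assumes p: "prime p" "odd p"
  assumes "finite S" "\<And>x. x \<in> S \<Longrightarrow> \<not> p dvd x"
    and "\<And>x. x \<in> S \<Longrightarrow> [x ^ (2 ^ j) = c] (mod p ^ e)"
  shows "card ((\<lambda>x. x mod p ^ e) ` S) \<le> 2 ^ j"
  using assms(3-)
proof (induction j arbitrary: S)
  case 0
  then have "(\<lambda>x. x mod p ^ e) ` S \<subseteq> {c mod p ^ e}" by (auto simp: cong_def)
  then have "card ((\<lambda>x. x mod p ^ e) ` S) \<le> card {c mod p ^ e}" by (intro card_mono) auto
  then show ?case by simp
next
  case (Suc j)
  define A where "A = (\<lambda>x. x mod p ^ e) ` S"
  define g where "g = (\<lambda>a. a\<^sup>2 mod p ^ e)"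
  \<comment> \<open>Squaring the residues of \<open>S\<close> gives the residues of the squares of
    \<open>S\<close>, to which the induction hypothesis for \<open>j\<close> applies.\<close>
  have gA: "g ` A = (\<lambda>x. x mod p ^ e) ` ((\<lambda>x. x\<^sup>2) ` S)"
    unfolding A_def g_def by (simp add: image_image power_mod)
  have "card A \<le> 2 * card (g ` A)"
  proof (rule card_le_mult_card_image)
    show "finite A" using Suc by (simp add: A_def)
  next
    fix y assume "y \<in> g ` A"
    then obtain x where x: "x \<in> S" "y = x\<^sup>2 mod p ^ e" unfolding gA by auto
    have "{a \<in> A. g a = y} \<subseteq> {x mod p ^ e, (- x) mod p ^ e}"
    proof
      fix a assume "a \<in> {a \<in> A. g a = y}"
      then obtain z where z: "z \<in> S" "a = z mod p ^ e" "z\<^sup>2 mod p ^ e = x\<^sup>2 mod p ^ e"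
        using x by (auto simp: A_def g_def power_mod)
      then have "p ^ e dvd z\<^sup>2 - x\<^sup>2" by (simp add: mod_eq_dvd_iff)
      then have "p ^ e dvd z - x \<or> p ^ e dvd z + x"
        using Suc.prems z p by (intro prime_power_dvd_diff_squares) auto
      then have "p ^ e dvd z - x \<or> p ^ e dvd z - (- x)" by simp
      then show "a \<in> {x mod p ^ e, (- x) mod p ^ e}"
        using z(2) by (auto simp: mod_eq_dvd_iff)
    qed
    then have "card {a \<in> A. g a = y} \<le> card {x mod p ^ e, (- x) mod p ^ e}"
      by (intro card_mono) auto
    also have "\<dots> \<le> 2" by (simp add: card_insert_if)
    finally show "card {a \<in> A. g a = y} \<le> 2" .
  qed
  also have "card (g ` A) \<le> 2 ^ j"
    unfolding gA
  proof (rule Suc.IH)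
    fix y assume "y \<in> (\<lambda>x. x\<^sup>2) ` S"
    then obtain x where x: "x \<in> S" "y = x\<^sup>2" by auto
    show "\<not> p dvd y" using Suc.prems(2)[OF x(1)] x p by (simp add: prime_dvd_power_iff)
    show "[y ^ 2 ^ j = c] (mod p ^ e)" using Suc.prems(3)[OF x(1)] x by (simp flip: power_mult)
  qed (use Suc.prems(1) in auto)
  finally show ?case by (simp add: A_def)
qed

section \<open>Counting the arguments up to N whose value is divisible by a prime power\<close>

definition root_set :: "nat \<Rightarrow> nat \<Rightarrow> nat \<Rightarrow> nat set" where
  "root_set k N m = {n \<in> {1..N}. m dvd n ^ 2 ^ k + 1}"

lemma finite_root_set [simp]: "finite (root_set k N m)"
  by (simp add: root_set_def)

lemma root_set_cong:
  assumes "n \<in> root_set k N m"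
  shows "[int n ^ 2 ^ k = -1] (mod int m)"
proof -
  have "int m dvd int (n ^ 2 ^ k + 1)" using assms by (simp only: root_set_def of_nat_dvd_iff) auto
  then show ?thesis by (simp add: cong_iff_dvd_diff add.commute)
qed

lemma root_set_coprime:
  assumes "prime p" "e > 0" "n \<in> root_set k N (p ^ e)"
  shows "\<not> p dvd n"
proof
  assume "p dvd n"
  then have "p dvd n ^ 2 ^ k" by (simp add: dvd_power_same dvd_trans[OF _ dvd_power])
  moreover have "p dvd n ^ 2 ^ k + 1"
    using assms by (auto simp: root_set_def intro: dvd_trans[of p "p ^ e"])
  ultimately show False using assms(1) by (metis dvd_add_right_iff not_prime_unit)
qed

text \<open>A number is determined by its residue and its quotient modulo \<open>p ^ e\<close>. At
  most \<open>2 ^ k\<close> residues are roots, and the quotients range over 0 to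
  \<open>N div p ^ e\<close>.\<close>

lemma card_root_set_le:
  assumes "prime p" "odd p" "e > 0"
  shows "card (root_set k N (p ^ e)) \<le> 2 ^ k * (N div p ^ e + 1)"
proof -
  define S where "S = root_set k N (p ^ e)"
  define R where "R = (\<lambda>x. x mod int p ^ e) ` int ` S"
  have R: "card R \<le> 2 ^ k"
    unfolding R_def
  proof (rule card_roots_2power_le)
    fix x assume "x \<in> int ` S"
    then obtain n where n: "x = int n" "n \<in> S" by auto
    then show "\<not> int p dvd x" using root_set_coprime[OF assms(1,3)] by (auto simp: S_def)
    show "[x ^ 2 ^ k = -1] (mod int p ^ e)" using root_set_cong n by (force simp: S_def)
  qed (use assms in \<open>auto simp: S_def\<close>)
  have "finite R" by (simp add: R_def S_def)
  have "inj_on (\<lambda>n. (int n mod int p ^ e, n div p ^ e)) S"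
  proof (rule inj_onI, clarify)
    fix m n assume *: "int m mod int p ^ e = int n mod int p ^ e" "m div p ^ e = n div p ^ e"
    have "m mod p ^ e = n mod p ^ e" using *(1) by (metis of_nat_mod of_nat_power of_nat_eq_iff)
    then show "m = n" using *(2) by (metis div_mult_mod_eq)
  qed
  moreover have "(\<lambda>n. (int n mod int p ^ e, n div p ^ e)) ` S \<subseteq> R \<times> {0..N div p ^ e}"
    by (auto simp: R_def S_def root_set_def intro!: div_le_mono)
  ultimately have "card S \<le> card (R \<times> {0..N div p ^ e})"
    using \<open>finite R\<close> by (intro card_inj_on_le) auto
  also have "\<dots> = card R * (N div p ^ e + 1)" by (simp add: card_cartesian_product)
  also have "\<dots> \<le> 2 ^ k * (N div p ^ e + 1)" using R by (intro mult_right_mono) auto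
  finally show ?thesis by (simp add: S_def)
qed

text \<open>If there were more than \<open>2 ^ j\<close> elements, two of their \<open>2 ^ (i + 1)\<close>-th powers would be congruent
  modulo \<open>p ^ e\<close>, so that \<open>p ^ e\<close> would divide a nonzero sum or difference of two \<open>2 ^ i\<close>-th powers.\<close>
lemma card_root_set_large_prime_le:
  assumes p: "prime p" "p > 2 * N" and e: "e \<ge> 2 ^ i"
  shows "card (root_set (i + 1 + j) N (p ^ e)) \<le> 2 ^ j"
proof (cases "N = 0")
  case False
  define S where "S = root_set (i + 1 + j) N (p ^ e)"
  define g where "g n = int n ^ 2 ^ (i + 1) mod int p ^ e" for n
  have odd: "odd p" using p False prime_odd_nat[of p] by auto
  have e0: "e > 0" using e by (metis less_le_trans zero_less_numeral zero_less_power)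
  have inj: "inj_on g S"
  proof (rule inj_onI, rule ccontr)
    fix m n assume mn: "m \<in> S" "n \<in> S" "g m = g n" "m \<noteq> n"
    define a b where "a = int m ^ 2 ^ i" and "b = int n ^ 2 ^ i"
    have "int p ^ e dvd a\<^sup>2 - b\<^sup>2"
      using mn(3) unfolding g_def a_def b_def mod_eq_dvd_iff power_mult[symmetric] by (simp add: mult.commute)
    moreover have "\<not> int p dvd a"
      using root_set_coprime[OF p(1) e0] mn(1) p(1)
      by (auto simp: S_def a_def prime_dvd_power_iff)
    ultimately have "int p ^ e dvd a - b \<or> int p ^ e dvd a + b"
      using p odd by (intro prime_power_dvd_diff_squares) auto
    moreover have ab: "a \<noteq> b" "a > 0" "b > 0"
      using mn by (auto simp: a_def b_def S_def root_set_def power_eq_iff_eq_base)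
    moreover have "a \<le> int N ^ 2 ^ i" "b \<le> int N ^ 2 ^ i"
      using mn by (auto simp: a_def b_def S_def root_set_def intro!: power_mono)
    ultimately have "int p ^ e \<le> \<bar>a - b\<bar> \<or> int p ^ e \<le> \<bar>a + b\<bar>"
      using dvd_imp_le_int[of "a - b" "int p ^ e"] dvd_imp_le_int[of "a + b" "int p ^ e"] by auto
    then have "int p ^ e \<le> 2 * int N ^ 2 ^ i"
      using ab \<open>a \<le> _\<close> \<open>b \<le> _\<close> by linarith
    \<comment> \<open>The factor 2 is absorbed into the power so that the bound becomes a power of 2
      N, which \<open>p > 2 * N\<close> and \<open>e \<ge> 2 ^ i\<close> contradict.\<close>
    also have "\<dots> \<le> 2 ^ 2 ^ i * int N ^ 2 ^ i"
      by (intro mult_right_mono self_le_power) auto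
    also have "\<dots> = int (2 * N) ^ 2 ^ i" by (simp add: power_mult_distrib)
    also have "\<dots> < int p ^ 2 ^ i" using p by (intro power_strict_mono) auto
    also have "\<dots> \<le> int p ^ e" using e p by (intro power_increasing) (auto dest: prime_gt_0_nat)
    finally show False by simp
  qed
  have "card S = card (g ` S)" using inj by (simp add: card_image)
  also have "g ` S = (\<lambda>x. x mod int p ^ e) ` (\<lambda>n. int n ^ 2 ^ (i + 1)) ` S"
    by (auto simp: g_def image_image)
  also have "card \<dots> \<le> 2 ^ j"
  proof (rule card_roots_2power_le)
    fix x assume "x \<in> (\<lambda>n. int n ^ 2 ^ (i + 1)) ` S"
    then obtain n where n: "x = int n ^ 2 ^ (i + 1)" "n \<in> S" by auto
    then show "\<not> int p dvd x"
      using root_set_coprime[OF p(1) e0] p(1) by (auto simp: S_def prime_dvd_power_iff)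
    have "x ^ 2 ^ j = int n ^ 2 ^ (i + 1 + j)"
      unfolding n(1) power_mult[symmetric] power_add[symmetric] ..
    then show "[x ^ 2 ^ j = -1] (mod int p ^ e)" using root_set_cong n by (force simp: S_def)
  qed (use p odd in \<open>auto simp: S_def\<close>)
  finally show ?thesis by (simp add: S_def)
qed (simp add: root_set_def)

section \<open>From root counts to multiplicities\<close>

lemma multiplicity_eq_card_powers:
  fixes m :: nat
  assumes "prime p" "m > 0" "m < p ^ Suc E"
  shows "multiplicity p m = card {e \<in> {1..E}. p ^ e dvd m}"
proof -
  have "p ^ multiplicity p m \<le> m" using assms(2) by (intro dvd_imp_le multiplicity_dvd)
  then have "p ^ multiplicity p m < p ^ Suc E" using assms(3) by (rule le_less_trans)
  then have less: "multiplicity p m < Suc E"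
    by (rule power_less_imp_less_exp[OF prime_gt_1_nat[OF assms(1)]])
  have "\<not> is_unit p" using prime_gt_1_nat[OF assms(1)] by simp
  then have dvd_iff: "p ^ e dvd m \<longleftrightarrow> e \<le> multiplicity p m" for e
    using assms(2) by (intro power_dvd_iff_le_multiplicity) simp_all
  have "{e \<in> {1..E}. p ^ e dvd m} = {1..multiplicity p m}"
    unfolding dvd_iff using less by auto
  then show ?thesis by simp
qed

text \<open>Double counting of the pairs (n, e) for which \<open>p ^ e\<close> divides the value at
  n. The hypothesis on \<open>E\<close> ensures that no larger exponent occurs.\<close>

lemma sum_multiplicity_eq:
  assumes "prime p" "N ^ 2 ^ k + 1 < p ^ Suc E"
  shows "(\<Sum>n=1..N. multiplicity p (n ^ 2 ^ k + 1)) = (\<Sum>e=1..E. card (root_set k N (p ^ e)))"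
proof -
  have "(\<Sum>n=1..N. multiplicity p (n ^ 2 ^ k + 1)) = (\<Sum>n=1..N. card {e \<in> {1..E}. p ^ e dvd n ^ 2 ^ k + 1})"
  proof (intro sum.cong refl multiplicity_eq_card_powers)
    fix n assume "n \<in> {1..N}"
    then have "n ^ 2 ^ k + 1 \<le> N ^ 2 ^ k + 1" by (intro add_mono power_mono) auto
    then show "n ^ 2 ^ k + 1 < p ^ Suc E" using assms(2) by (rule le_less_trans)
  qed (use assms in auto)
  also have "\<dots> = (\<Sum>n=1..N. \<Sum>e=1..E. if p ^ e dvd n ^ 2 ^ k + 1 then 1 else 0)"
    by (simp add: sum.If_cases Int_def)
  also have "\<dots> = (\<Sum>e=1..E. \<Sum>n=1..N. if p ^ e dvd n ^ 2 ^ k + 1 then 1 else 0)"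
    by (rule sum.swap)
  also have "\<dots> = (\<Sum>e=1..E. card (root_set k N (p ^ e)))"
    by (simp add: sum.If_cases Int_def root_set_def)
  finally show ?thesis .
qed

text \<open>The exponents are cut into dyadic blocks from \<open>2 ^ m\<close> to below
  \<open>2 ^ Suc m\<close>. Such a block has \<open>2 ^ m\<close> exponents with at most
  \<open>2 ^ (k - 1 - m)\<close> roots each, so each of the \<open>k\<close> blocks contributes at
  most \<open>2 ^ (k - 1)\<close>.\<close>

lemma sum_multiplicity_large_prime_le:
  fixes p N k :: nat
  assumes p: "prime p" "p > 2 * N"
  shows "(\<Sum>n=1..N. multiplicity p (n ^ 2 ^ k + 1)) \<le> k * 2 ^ (k - 1)"
proof (cases "N = 0")
  case False
  have "(\<Sum>n=1..N. multiplicity p (n ^ 2 ^ k + 1)) = (\<Sum>e=1..2 ^ k - 1. card (root_set k N (p ^ e)))"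
  proof (rule sum_multiplicity_eq)
    \<comment> \<open>Exponents from \<open>2 ^ k\<close> on do not occur, because every value is
      below (2 N + 1)^(2^k), which is at most \<open>p ^ 2 ^ k\<close>. Writing \<open>2 ^ k\<close>
      as \<open>Suc m\<close> lets one factor be split off for this comparison.\<close>
    define m :: nat where "m = 2 ^ k - 1"
    have m: "2 ^ k = Suc m" by (simp add: m_def)
    have "N ^ Suc m + 1 \<le> N * (2 * N + 1) ^ m + (2 * N + 1) ^ m"
      unfolding power_Suc by (intro add_mono mult_mono power_mono) auto
    also have "\<dots> < 2 * N * (2 * N + 1) ^ m + (2 * N + 1) ^ m" using False by simp
    also have "\<dots> = (2 * N + 1) ^ Suc m" by simp
    also have "\<dots> \<le> p ^ Suc m" using p by (intro power_mono) auto
    finally show "N ^ 2 ^ k + 1 < p ^ Suc (2 ^ k - 1)" by (simp only: m diff_Suc_1)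
  qed (use p in auto)
  also have "\<dots> \<le> k * 2 ^ (k - 1)"
  proof -
    have "(\<Sum>e=1..2 ^ m - 1. card (root_set k N (p ^ e))) \<le> m * 2 ^ (k - 1)" if "m \<le> k" for m
      using that
    proof (induction m)
      case (Suc m)
      have "{1..2 ^ Suc m - 1} = {1..2 ^ m - 1} \<union> {2 ^ m..<2 ^ Suc m :: nat}"
      proof -
        have "(1::nat) \<le> 2 ^ m" by simp
        then show ?thesis unfolding power_Suc by (intro set_eqI) (simp, linarith)
      qed
      then have "(\<Sum>e=1..2 ^ Suc m - 1. card (root_set k N (p ^ e))) =
          (\<Sum>e=1..2 ^ m - 1. card (root_set k N (p ^ e))) + (\<Sum>e\<in>{2 ^ m..<2 ^ Suc m :: nat}. card (root_set k N (p ^ e)))"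
        by (simp only:) (rule sum.union_disjoint, auto)
      also have "(\<Sum>e\<in>{2 ^ m..<2 ^ Suc m :: nat}. card (root_set k N (p ^ e))) \<le> (\<Sum>e\<in>{2 ^ m..<2 ^ Suc m :: nat}. 2 ^ (k - 1 - m))"
      proof (rule sum_mono)
        fix e :: nat assume "e \<in> {2 ^ m..<2 ^ Suc m}"
        then show "card (root_set k N (p ^ e)) \<le> 2 ^ (k - 1 - m)"
          using card_root_set_large_prime_le[OF p, of m e "k - 1 - m"] Suc.prems by simp
      qed
      also have "\<dots> = 2 ^ (k - 1)" using Suc.prems by (simp flip: power_add)
      finally show ?case using Suc by simp
    qed simp
    then show ?thesis by simp
  qed
  finally show ?thesis .
qed simp

section \<open>Norms from cyclotomic fields of two-power conductor\<close>

text \<open>The l1 norm measures size here because it is submultiplicative and additive over the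
  even and odd parts of a polynomial, so norms can be bounded without complex embeddings.\<close>

definition coeff_norm :: "int poly \<Rightarrow> int" where
  "coeff_norm p = (\<Sum>c\<leftarrow>coeffs p. \<bar>c\<bar>)"

lemma coeff_norm_0 [simp]: "coeff_norm 0 = 0"
  by (simp add: coeff_norm_def)

lemma coeff_norm_pCons [simp]: "coeff_norm (pCons a p) = \<bar>a\<bar> + coeff_norm p"
  by (cases "a = 0 \<and> p = 0") (auto simp: coeff_norm_def coeffs_pCons_eq_cCons cCons_def)

lemma coeff_norm_nonneg: "coeff_norm p \<ge> 0"
  by (induction p) auto

lemma coeff_norm_add: "coeff_norm (p + q) \<le> coeff_norm p + coeff_norm q"
proof (induction p arbitrary: q)
  case (pCons a p)
  then show ?case
  proof (cases q rule: pCons_cases)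
    case (pCons b q')
    then show ?thesis using pCons.IH[of q'] abs_triangle_ineq[of a b] by simp
  qed
qed simp

lemma coeff_norm_smult [simp]: "coeff_norm (smult c p) = \<bar>c\<bar> * coeff_norm p"
  by (induction p) (auto simp: abs_mult algebra_simps)


lemma coeff_norm_uminus [simp]: "coeff_norm (- p) = coeff_norm p"
  by (induction p) auto

lemma coeff_norm_mult: "coeff_norm (p * q) \<le> coeff_norm p * coeff_norm q"
proof (induction p)
  case (pCons a p)
  have "coeff_norm (pCons a p * q) \<le> coeff_norm (smult a q) + coeff_norm (pCons 0 (p * q))"
    using coeff_norm_add[of "smult a q" "pCons 0 (p * q)"] by simp
  then show ?case using pCons by (simp add: algebra_simps)
qed simp

lemma abs_poly_minus_one_le: "\<bar>poly p (-1)\<bar> \<le> coeff_norm p"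
  by (induction p) auto

lemma coeff_norm_le:
  assumes "degree p < d" "\<And>i. \<bar>coeff p i\<bar> \<le> c"
  shows "coeff_norm p \<le> int d * c"
proof -
  have "coeff_norm p = (\<Sum>i<length (coeffs p). \<bar>coeffs p ! i\<bar>)"
    unfolding coeff_norm_def by (simp add: sum_list_sum_nth atLeast0LessThan)
  also have "\<dots> \<le> (\<Sum>i<length (coeffs p). c)"
  proof (rule sum_mono)
    fix i assume "i \<in> {..<length (coeffs p)}"
    then have "p \<noteq> 0" "i \<le> degree p" by (cases "p = 0"; simp add: length_coeffs)+
    then show "\<bar>coeffs p ! i\<bar> \<le> c" using assms(2) by (simp add: coeffs_nth)
  qed
  also have "\<dots> \<le> int d * c"
  proof -
    have "length (coeffs p) \<le> d" using assms(1) by (cases "p = 0") (auto simp: length_coeffs)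
    moreover have "c \<ge> 0" using assms(2)[of 0] by linarith
    ultimately show ?thesis by (simp add: mult_right_mono)
  qed
  finally show ?thesis .
qed

text \<open>Prepending a coefficient raises every exponent by one. Thus the even part
  \<open>u\<close> becomes the odd part, and \<open>v\<close> with the new constant term becomes the
  even part.\<close>

lemma poly_even_odd_decomposition:
  fixes p :: "int poly"
  obtains u v where
    "p = pcompose u [:0, 0, 1:] + [:0, 1:] * pcompose v [:0, 0, 1:]"
    "coeff_norm u + coeff_norm v = coeff_norm p"
proof -
  have "\<exists>u v. p = pcompose u [:0, 0, 1:] + [:0, 1:] * pcompose v [:0, 0, 1:] \<and>
      coeff_norm u + coeff_norm v = coeff_norm p"
  proof (induction p)
    case 0
    show ?case by (intro exI[of _ 0]) simp
  next
    case (pCons a p)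
    then obtain u v where uv: "p = pcompose u [:0, 0, 1:] + [:0, 1:] * pcompose v [:0, 0, 1:]"
      "coeff_norm u + coeff_norm v = coeff_norm p" by auto
    have "pCons a p = [:a:] + [:0, 1:] * p" by simp
    also have "\<dots> = pcompose (pCons a v) [:0, 0, 1:] + [:0, 1:] * pcompose u [:0, 0, 1:]"
      by (subst (1) uv(1)) (simp add: pcompose_pCons algebra_simps)
    finally have "pCons a p = pcompose (pCons a v) [:0, 0, 1:] + [:0, 1:] * pcompose u [:0, 0, 1:]" .
    moreover have "coeff_norm (pCons a v) + coeff_norm u = coeff_norm (pCons a p)" using uv(2) by simp
    ultimately show ?case by blast
  qed
  then show ?thesis using that by blast
qed

section \<open>Irreducibility of X^(2^k) + 1 over the integers\<close>

lemma eisenstein_two_degree_eq_0: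
  fixes g h :: "int poly"
  assumes "lead_coeff (g * h) = 1" "\<And>i. i \<noteq> degree (g * h) \<Longrightarrow> even (coeff (g * h) i)"
    and "coeff (g * h) 0 = 2" "even (coeff g 0)"
  shows "degree h = 0"
proof -
  have nz: "g \<noteq> 0" "h \<noteq> 0" using assms(1) by auto
  have "odd (lead_coeff g)" using assms(1) by (metis dvd_mult2 lead_coeff_mult odd_one)
  \<comment> \<open>Eisenstein's argument at 2: as the constant terms multiply to 2, that of
    \<open>h\<close> is odd, so the first odd coefficient of \<open>g\<close> yields an odd
    coefficient of the product at the same index. That index must be the degree of the product, yet
    it is at most the degree of \<open>g\<close>.\<close>
  define i where "i = (LEAST i. odd (coeff g i))"
  have i: "odd (coeff g i)" unfolding i_def by (rule LeastI) fact
  have less: "even (coeff g j)" if "j < i" for j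
    using not_less_Least[of j "\<lambda>i. odd (coeff g i)"] that unfolding i_def by blast
  have "odd (coeff h 0)"
  proof
    assume "even (coeff h 0)"
    then have "2 * 2 dvd coeff g 0 * coeff h 0" using assms(4) by (rule mult_dvd_mono[rotated])
    then show False using assms(3) by (simp add: coeff_mult_0)
  qed
  have "coeff (g * h) i = (\<Sum>j\<le>i. coeff g j * coeff h (i - j))" by (rule coeff_mult)
  also have "\<dots> = (\<Sum>j<i. coeff g j * coeff h (i - j)) + coeff g i * coeff h 0"
    by (simp add: lessThan_Suc_atMost[symmetric])
  moreover have "even (\<Sum>j<i. coeff g j * coeff h (i - j))" using less by (intro dvd_sum) auto
  ultimately have "odd (coeff (g * h) i)" using i \<open>odd (coeff h 0)\<close> by simp
  then have "i = degree (g * h)" using assms(2) by blast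
  moreover have "i \<le> degree g" using i by (metis even_zero le_degree)
  ultimately show ?thesis using nz by (simp add: degree_mult_eq)
qed

text \<open>Frobenius modulo 2: each squaring produces only even cross terms. This makes the middle
  coefficients even in the Eisenstein argument.\<close>

lemma linear_two_power_mod_2:
  "\<exists>q::int poly. [:1, 1:] ^ 2 ^ k = monom 1 (2 ^ k) + 1 + 2 * q"
proof (induction k)
  case 0
  show ?case by (intro exI[of _ 0]) (simp add: monom_altdef one_pCons)
next
  case (Suc k)
  then obtain q :: "int poly" where q: "[:1, 1:] ^ 2 ^ k = monom 1 (2 ^ k) + 1 + 2 * q" by auto
  have "[:1, 1:] ^ 2 ^ Suc k = ([:1, 1:] ^ 2 ^ k)\<^sup>2" by (simp flip: power_mult add: mult.commute)
  also have "\<dots> = (monom 1 (2 ^ k))\<^sup>2 + 1 + 2 * (monom 1 (2 ^ k) + 2 * q * (monom 1 (2 ^ k) + 1) + 2 * q\<^sup>2)"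
    unfolding q by (simp add: power2_eq_square algebra_simps)
  also have "(monom (1::int) (2 ^ k))\<^sup>2 = monom 1 (2 ^ Suc k)" by (simp add: monom_power mult.commute)
  finally show ?case by blast
qed

lemma lead_coeff_monom_add_one:
  assumes "n > 0"
  shows "degree (monom 1 n + 1 :: int poly) = n" "lead_coeff (monom 1 n + 1 :: int poly) = 1"
proof -
  show d: "degree (monom 1 n + 1 :: int poly) = n"
    using assms by (subst degree_add_eq_left) (auto simp: degree_monom_eq)
  show "lead_coeff (monom 1 n + 1 :: int poly) = 1"
    using assms unfolding d by simp
qed

text \<open>Substituting X + 1 gives a monic polynomial with constant term 2 and all other lower
  coefficients even, so Eisenstein makes one factor constant. Since the product is monic, that
  constant is a unit.\<close>

lemma irreducible_monom_two_power_add_one: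
  "irreducible (monom 1 (2 ^ k) + 1 :: int poly)" (is "irreducible ?f")
proof (rule irreducibleI)
  have deg: "degree ?f = 2 ^ k" "lead_coeff ?f = 1" by (rule lead_coeff_monom_add_one; simp)+
  show "?f \<noteq> 0" using deg by auto
  show "\<not> ?f dvd 1" using deg by (auto simp: is_unit_poly_iff)
  fix g h assume gh: "?f = g * h"
  let ?s = "[:1, 1::int:]"
  have F: "pcompose ?f ?s = pcompose g ?s * pcompose h ?s" by (simp add: gh pcompose_mult)
  have degF: "degree (pcompose ?f ?s) = 2 ^ k" using deg by (simp add: degree_pcompose)
  have lcF: "lead_coeff (pcompose ?f ?s) = 1" using deg by (subst lead_coeff_comp) auto
  obtain q :: "int poly" where q: "?s ^ 2 ^ k = monom 1 (2 ^ k) + 1 + 2 * q"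
    using linear_two_power_mod_2 by blast
  have "pcompose ?f ?s = ?s ^ 2 ^ k + 1" 
    by (rule poly_ext) (simp add: poly_pcompose poly_monom)
  also have "\<dots> = monom 1 (2 ^ k) + smult 2 (q + 1)" unfolding q by (simp add: numeral_poly smult_add_right one_pCons)
  finally have even: "even (coeff (pcompose ?f ?s) i)" if "i \<noteq> 2 ^ k" for i using that by simp
  have c0: "coeff (pcompose ?f ?s) 0 = 2" by (simp add: poly_0_coeff_0[symmetric] poly_pcompose poly_monom)
  have unit: "b dvd 1" if "?f = a * b" "degree b = 0" for a b
  proof -
    obtain c where c: "b = [:c:]" using \<open>degree b = 0\<close> by (rule degree_eq_zeroE)
    have "lead_coeff a * c = 1" using deg(2) unfolding that(1) lead_coeff_mult c by simp
    then have "c dvd 1" by (metis dvd_triv_right)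
    then show ?thesis by (simp add: c is_unit_const_poly_iff)
  qed
  have "even (coeff (pcompose g ?s) 0 * coeff (pcompose h ?s) 0)"
    using c0 unfolding F coeff_mult_0 by simp
  then consider "even (coeff (pcompose g ?s) 0)" | "even (coeff (pcompose h ?s) 0)" by auto
  then show "g dvd 1 \<or> h dvd 1"
  proof cases
    case 1
    then have "degree (pcompose h ?s) = 0"
      using eisenstein_two_degree_eq_0[of "pcompose g ?s" "pcompose h ?s"] lcF c0 degF even
      unfolding F by auto
    then show ?thesis using unit[OF gh] by (simp add: degree_pcompose)
  next
    case 2
    then have "degree (pcompose g ?s) = 0"
      using eisenstein_two_degree_eq_0[of "pcompose h ?s" "pcompose g ?s"] lcF c0 degF even
      unfolding F by (auto simp: mult.commute)
    then show ?thesis using unit[of h g] gh by (simp add: degree_pcompose mult.commute)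
  qed
qed

section \<open>The integer norm and its congruences\<close>

lemma poly_cong_int:
  fixes p :: "int poly"
  assumes "[x = y] (mod m)"
  shows "[poly p x = poly p y] (mod m)"
  using assms by (induction p) (auto intro: cong_add cong_mult)

text \<open>The integer obtained is the norm of \<open>A(\<zeta>)\<close> for a primitive \<open>2 ^ (k + 1)\<close>-th root of unity \<open>\<zeta>\<close>.
  It is computed through the tower of quadratic extensions, writing \<open>A(x) A(-x) = B(x\<^sup>2)\<close>.\<close>
lemma cyclotomic_norm:
  fixes A :: "int poly"
  shows "\<exists>n::int. \<bar>n\<bar> \<le> coeff_norm A ^ 2 ^ k \<and> (n = 0 \<longrightarrow> monom 1 (2 ^ k) + 1 dvd A) \<and>
    (\<forall>r m. m dvd r ^ 2 ^ k + 1 \<longrightarrow> [n = (\<Prod>j<2 ^ k. poly A (r ^ (2 * j + 1)))] (mod m))"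
proof (induction k arbitrary: A)
  case 0
  have "[:1, 1:] dvd A" if "poly A (-1) = 0"
    using that poly_eq_0_iff_dvd[of A "-1"] by simp
  moreover have "[poly A (-1) = poly A r] (mod m)" if "m dvd r + 1" for r m
  proof (rule poly_cong_int)
    show "[-1 = r] (mod m)" using that by (simp add: cong_iff_dvd_diff dvd_diff_commute)
  qed
  ultimately show ?case
    using abs_poly_minus_one_le[of A] by (intro exI[of _ "poly A (-1)"]) (auto simp: monom_altdef one_pCons)
next
  case (Suc k)
  let ?sq = "[:0, 0, 1::int:]" and ?neg = "[:0, -1::int:]"
  let ?f = "monom 1 (2 ^ Suc k) + 1 :: int poly"
  obtain u v where A: "A = pcompose u ?sq + [:0, 1:] * pcompose v ?sq"
    and uv: "coeff_norm u + coeff_norm v = coeff_norm A"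
    by (rule poly_even_odd_decomposition)
  \<comment> \<open>With A(x) = u(x^2) + x v(x^2) the product A(x) A(-x) is u(x^2)^2 - x^2 v(x^2)^2,
    which is B(x^2).\<close>
  define B where "B = u * u + [:0, -1:] * (v * v)"
  have sq_neg: "pcompose (pcompose w ?sq) ?neg = pcompose w ?sq" for w
    by (simp add: pcompose_assoc[symmetric] pcompose_pCons)
  have Aneg: "pcompose A ?neg = pcompose u ?sq - [:0, 1:] * pcompose v ?sq"
    unfolding A pcompose_add pcompose_mult sq_neg by (simp add: pcompose_pCons)
  have AB: "A * pcompose A ?neg = pcompose B ?sq"
    unfolding Aneg B_def
    by (rule poly_ext) (simp add: A poly_pcompose algebra_simps)
  have polyB: "poly B (x\<^sup>2) = poly A x * poly A (- x)" for x
    using arg_cong[OF AB, of "\<lambda>p. poly p x"] by (simp add: poly_pcompose power2_eq_square)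
  have "coeff_norm B \<le> coeff_norm (u * u) + coeff_norm ([:0, -1:] * (v * v))"
    unfolding B_def by (rule coeff_norm_add)
  also have "\<dots> = coeff_norm (u * u) + coeff_norm (v * v)" by simp
  also have "\<dots> \<le> coeff_norm u * coeff_norm u + coeff_norm v * coeff_norm v"
    by (intro add_mono coeff_norm_mult)
  also have "\<dots> \<le> (coeff_norm u + coeff_norm v)\<^sup>2"
    using coeff_norm_nonneg[of u] coeff_norm_nonneg[of v]
    by (simp add: power2_eq_square algebra_simps)
  finally have normB: "coeff_norm B \<le> (coeff_norm A)\<^sup>2" using uv by simp
  obtain n where n: "\<bar>n\<bar> \<le> coeff_norm B ^ 2 ^ k" "n = 0 \<longrightarrow> monom 1 (2 ^ k) + 1 dvd B"
    "\<And>r m. m dvd r ^ 2 ^ k + 1 \<Longrightarrow> [n = (\<Prod>j<2 ^ k. poly B (r ^ (2 * j + 1)))] (mod m)"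
    using Suc.IH[of B] by blast
  have "\<bar>n\<bar> \<le> ((coeff_norm A)\<^sup>2) ^ 2 ^ k"
    using n(1) power_mono[OF normB coeff_norm_nonneg, of "2 ^ k"] by linarith
  then have "\<bar>n\<bar> \<le> coeff_norm A ^ 2 ^ Suc k" by (simp flip: power_mult)
  moreover have "?f dvd A" if "n = 0"
  proof -
    \<comment> \<open>Substituting X^2 into the divisibility for \<open>B\<close> shows that
      \<open>?f\<close> divides A(X) A(-X). As \<open>?f\<close> is prime and even in X, it divides
      A(X) in either case.\<close>
    have "pcompose (monom 1 (2 ^ k) + 1) ?sq dvd pcompose B ?sq"
      using n(2) that by (auto simp: pcompose_mult elim!: dvdE)
    also have "pcompose (monom 1 (2 ^ k) + 1) ?sq = ?f"
      by (rule poly_ext) (simp add: poly_pcompose poly_monom power2_eq_square[symmetric] flip: power_mult)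
    finally have "?f dvd A * pcompose A ?neg" by (simp only: AB)
    moreover have "prime_elem ?f"
      using irreducible_monom_two_power_add_one by (simp only: prime_elem_iff_irreducible)
    ultimately have "?f dvd A \<or> ?f dvd pcompose A ?neg" by (simp only: prime_elem_dvd_mult_iff)
    then show ?thesis
    proof
      assume "?f dvd pcompose A ?neg"
      then have "pcompose ?f ?neg dvd pcompose (pcompose A ?neg) ?neg"
        by (auto simp: pcompose_mult elim!: dvdE)
      also have "pcompose ?f ?neg = ?f"
        by (rule poly_ext) (simp add: poly_pcompose poly_monom)
      also have "pcompose (pcompose A ?neg) ?neg = A"
        by (rule poly_ext) (simp add: poly_pcompose)
      finally show ?thesis .
    qed
  qed
  moreover have "[n = (\<Prod>j<2 ^ Suc k. poly A (r ^ (2 * j + 1)))] (mod m)"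
    if m: "m dvd r ^ 2 ^ Suc k + 1" for r m
  proof -
    have "[n = (\<Prod>j<2 ^ k. poly B ((r\<^sup>2) ^ (2 * j + 1)))] (mod m)"
      by (rule n(3)) (use m in \<open>simp flip: power_mult\<close>)
    also have "(\<Prod>j<2 ^ k. poly B ((r\<^sup>2) ^ (2 * j + 1))) =
        (\<Prod>j<2 ^ k. poly A (r ^ (2 * j + 1)) * poly A (- (r ^ (2 * j + 1))))"
      by (intro prod.cong refl) (simp only: polyB[symmetric] power_mult[symmetric] mult.commute)
    also have "\<dots> = (\<Prod>j<2 ^ k. poly A (r ^ (2 * j + 1))) * (\<Prod>j<2 ^ k. poly A (- (r ^ (2 * j + 1))))"
      by (rule prod.distrib)
    \<comment> \<open>Since \<open>r ^ 2 ^ Suc k\<close> is -1 modulo \<open>m\<close>, negating an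
      odd power of \<open>r\<close> adds \<open>2 ^ Suc k\<close> to its exponent. The factors A(-x)
      therefore supply the upper half of the odd exponents.\<close>
    also have "[\<dots> = (\<Prod>j<2 ^ k. poly A (r ^ (2 * j + 1))) * (\<Prod>j<2 ^ k. poly A (r ^ (2 * (j + 2 ^ k) + 1)))] (mod m)"
    proof (intro cong_mult cong_refl cong_prod poly_cong_int)
      fix j
      have "r ^ (2 * (j + 2 ^ k) + 1) = r ^ (2 * j + 1) * r ^ 2 ^ Suc k"
        by (simp flip: power_add add: algebra_simps)
      moreover have "[r ^ 2 ^ Suc k = -1] (mod m)" using m by (simp add: cong_iff_dvd_diff)
      then have "[r ^ (2 * j + 1) * r ^ 2 ^ Suc k = r ^ (2 * j + 1) * -1] (mod m)"
        by (rule cong_scalar_left)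
      ultimately show "[- (r ^ (2 * j + 1)) = r ^ (2 * (j + 2 ^ k) + 1)] (mod m)"
        by (metis cong_sym mult_minus1_right)
    qed
    also have "(\<Prod>j<2 ^ k. poly A (r ^ (2 * (j + 2 ^ k) + 1))) = (\<Prod>j\<in>{2 ^ k..<2 ^ Suc k}. poly A (r ^ (2 * j + 1)))"
      using prod.shift_bounds_nat_ivl[of "\<lambda>j. poly A (r ^ (2 * j + 1))" 0 "2 ^ k" "2 ^ k"]
      by (simp add: atLeast0LessThan mult_2)
    also have "(\<Prod>j<2 ^ k. poly A (r ^ (2 * j + 1))) * \<dots> = (\<Prod>j<2 ^ Suc k. poly A (r ^ (2 * j + 1)))"
      using prod.atLeastLessThan_concat[of 0 "2 ^ k" "2 ^ Suc k" "\<lambda>j. poly A (r ^ (2 * j + 1))"]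
      by (simp add: atLeast0LessThan)
    finally show ?thesis .
  qed
  ultimately show ?case by blast
qed

section \<open>Lifting roots to prime powers, and counting collisions\<close>

lemma power_prime_lift:
  fixes x :: int
  assumes "p ^ Suc e dvd x + 1" "odd p"
  shows "int p ^ Suc (Suc e) dvd x ^ p + 1"
proof -
  \<comment> \<open>The cofactor of x + 1 in x^p + 1 gains one more factor \<open>p\<close>: as x is
    -1 modulo \<open>p\<close>, each of its \<open>p\<close> terms is congruent to (-1)^(p-1) =
    1.\<close>
  have "x ^ p - (-1) ^ p = (x - (-1)) * (\<Sum>i<p. (-1) ^ (p - Suc i) * x ^ i)"
    by (rule power_diff_sumr2)
  moreover have "[(\<Sum>i<p. (-1) ^ (p - Suc i) * x ^ i) = (\<Sum>i<p. (-1) ^ (p - Suc i) * (-1) ^ i)] (mod int p)"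
  proof (intro cong_sum cong_scalar_left cong_pow)
    have "int p dvd x + 1" using assms(1) by (auto intro: dvd_trans[rotated])
    then show "[x = -1] (mod int p)" by (simp add: cong_iff_dvd_diff)
  qed
  moreover have "(\<Sum>i<p. (-1) ^ (p - Suc i) * (-1) ^ i) = (\<Sum>i<p. 1 :: int)"
    using \<open>odd p\<close> by (intro sum.cong refl) (simp flip: power_add)
  ultimately have "int p dvd (\<Sum>i<p. (-1) ^ (p - Suc i) * x ^ i)"
    by (simp add: cong_dvd_iff)
  then have "int p ^ Suc e * int p dvd (x + 1) * (\<Sum>i<p. (-1) ^ (p - Suc i) * x ^ i)"
    using assms(1) by (intro mult_dvd_mono) auto
  then show ?thesis
    using \<open>x ^ p - (-1) ^ p = _\<close> \<open>odd p\<close> by (simp add: mult.commute)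
qed

text \<open>Replacing the root \<open>s\<close> by \<open>s ^ p\<close> replaces
  \<open>s ^ d\<close> by its \<open>p\<close>-th power, which gains a factor \<open>p\<close> in
  the divisibility. No derivative condition on \<open>d\<close> is needed for this lift.\<close>

lemma exists_root_mod_prime_power:
  fixes r :: int
  assumes "odd p" "int p dvd r ^ d + 1"
  shows "\<exists>s. int p ^ Suc e dvd s ^ d + 1"
proof (induction e)
  case (Suc e)
  then obtain s where "int p ^ Suc e dvd s ^ d + 1" by auto
  then have "int p ^ Suc (Suc e) dvd (s ^ d) ^ p + 1" using assms(1) by (intro power_prime_lift)
  then have "int p ^ Suc (Suc e) dvd (s ^ p) ^ d + 1" by (simp flip: power_mult add: mult.commute)
  then show ?case by blast
qed (use assms in auto)

text \<open>Cauchy-Schwarz for the fibre sizes of \<open>g\<close>: they sum to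
  \<open>card S\<close>, and their squares sum to the number of colliding pairs.\<close>

lemma card_collisions_ge:
  assumes "finite S" "finite T" "g ` S \<subseteq> T"
  shows "real (card S) ^ 2 \<le> real (card T) * real (card {(x, y) \<in> S \<times> S. g x = g y})"
proof -
  define c where "c t = card {x \<in> S. g x = t}" for t
  have "card S = (\<Sum>t\<in>T. c t)"
    using sum.group[OF assms, of "\<lambda>_. 1::nat"] by (simp add: c_def)
  then have "real (card S) ^ 2 = (\<Sum>t\<in>T. real (c t)) ^ 2" by simp
  also have "\<dots> \<le> (\<Sum>t\<in>T. (real (c t))\<^sup>2) * card T" by (rule sum_squared_le_sum_of_squares)
  also have "(\<Sum>t\<in>T. (real (c t))\<^sup>2) = real (\<Sum>t\<in>T. card ({x \<in> S. g x = t} \<times> {x \<in> S. g x = t}))"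
    by (simp add: c_def card_cartesian_product power2_eq_square)
  also have "(\<Sum>t\<in>T. card ({x \<in> S. g x = t} \<times> {x \<in> S. g x = t})) =
      card (\<Union>t\<in>T. {x \<in> S. g x = t} \<times> {x \<in> S. g x = t})"
    using assms by (subst card_UN_disjoint) auto
  also have "(\<Union>t\<in>T. {x \<in> S. g x = t} \<times> {x \<in> S. g x = t}) = {(x, y) \<in> S \<times> S. g x = g y}"
    using assms(3) by auto
  finally show ?thesis by (simp add: mult.commute)
qed

section \<open>A Mertens-type upper bound\<close>

lemma prod_prime_powers_dvd:
  fixes n :: int
  assumes "finite S" "\<And>p. p \<in> S \<Longrightarrow> prime p" "\<And>p. p \<in> S \<Longrightarrow> int p ^ c p dvd n"
  shows "(\<Prod>p\<in>S. int p ^ c p) dvd n"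
  using assms
proof (induction S rule: finite_induct)
  case (insert p S)
  have "coprime (int p ^ c p) (\<Prod>p\<in>S. int p ^ c p)"
  proof (rule prod_coprime_right)
    fix q assume "q \<in> S"
    then have "coprime p q" using insert.hyps insert.prems(1) by (metis insertCI primes_coprime)
    then show "coprime (int p ^ c p) (int q ^ c q)" by simp
  qed
  with insert show ?case by (simp add: divides_mult)
qed auto

lemma prime_power_card_dvd_prod:
  assumes "finite J" shows "(p::int) ^ card {j \<in> J. p dvd g j} dvd (\<Prod>j\<in>J. g j)"
proof -
  have "p ^ card {j \<in> J. p dvd g j} = (\<Prod>j\<in>{j \<in> J. p dvd g j}. p)" by simp
  also have "\<dots> dvd (\<Prod>j\<in>{j \<in> J. p dvd g j}. g j)" by (rule prod_dvd_prod) auto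
  also have "\<dots> dvd (\<Prod>j\<in>J. g j)" using assms by (intro prod_dvd_prod_subset) auto
  finally show ?thesis .
qed

lemma real_card_filter:
  assumes "finite A" shows "real (card {x \<in> A. Q x}) = (\<Sum>x\<in>A. if Q x then 1 else 0)"
  using assms by (simp add: sum.If_cases Int_def)

text \<open>Count, weighted by \<open>ln p\<close>, the primes dividing the norms of the differences of two vectors of
  \<open>{0..<M} ^ 2 ^ k\<close>. By the pigeonhole principle the difference vanishes at a given root modulo \<open>p\<close> for at
  least the proportion \<open>1 / p\<close> of all pairs.\<close>
lemma sum_ln_div_root_primes_le:
  fixes Q :: "nat set"
  assumes M: "M \<ge> 1" and "finite Q"
    and Q: "\<And>p. p \<in> Q \<Longrightarrow> prime p" "\<And>p. p \<in> Q \<Longrightarrow> odd p" "\<And>p. p \<in> Q \<Longrightarrow> p \<le> M ^ 2 ^ k"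
    "\<And>p. p \<in> Q \<Longrightarrow> \<exists>r. int p dvd r ^ 2 ^ k + 1"
  shows "(\<Sum>p\<in>Q. ln (real p) / real p) \<le> ln (real M) + ln (2 ^ k) + ln 4"
proof -
  define d :: nat where "d = 2 ^ k"
  have d: "d \<ge> 1" "Suc (d - 1) = d" by (auto simp: d_def)
  \<comment> \<open>Roots modulo \<open>p ^ d\<close> are required: up to \<open>d\<close> factors
    of the norm congruence may be divisible by \<open>p\<close>, and a congruence modulo
    \<open>p\<close> alone would detect only one of them.\<close>
  have "\<forall>p\<in>Q. \<exists>s. int p ^ d dvd s ^ d + 1"
    using exists_root_mod_prime_power[where d = d and e = "d - 1"] Q(2,4) d(2) unfolding d_def by metis
  then obtain r where r: "\<And>p. p \<in> Q \<Longrightarrow> int p ^ d dvd r p ^ d + 1" by metis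
  obtain nrm where nrm: "\<And>A. \<bar>nrm A\<bar> \<le> coeff_norm A ^ d"
    "\<And>A. nrm A = 0 \<Longrightarrow> monom 1 d + 1 dvd A"
    "\<And>A x m. m dvd x ^ d + 1 \<Longrightarrow> [nrm A = (\<Prod>j<d. poly A (x ^ (2 * j + 1)))] (mod m)"
    using cyclotomic_norm[of _ k] unfolding d_def by metis
  define B where "B = {xs. set xs \<subseteq> {..<M} \<and> length xs = d}"
  define P where "P xs = Poly (map int xs)" for xs
  define D where "D = {(xs, ys) \<in> B \<times> B. xs \<noteq> ys}"
  have B: "finite B" "card B = M ^ d"
    unfolding B_def by (auto simp: finite_lists_length_eq card_lists_length_eq)
  have D: "finite D" "card D \<le> M ^ d * M ^ d"
  proof -
    have sub: "D \<subseteq> B \<times> B" by (auto simp: D_def)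
    then show "finite D" using B by (auto intro: finite_subset)
    show "card D \<le> M ^ d * M ^ d"
      using card_mono[OF _ sub] B by (simp add: card_cartesian_product)
  qed
  have coeffP: "coeff (P xs) i = (if i < d then int (xs ! i) else 0)" if "xs \<in> B" for xs i
    using that by (simp add: P_def B_def coeff_Poly_eq nth_default_def)
  define K where "K p A = card {j \<in> {..<d}. int p dvd poly A (r p ^ (2 * j + 1))}" for p A
  have log_bound: "(\<Sum>p\<in>Q. real (K p (P xs - P ys)) * ln (real p)) \<le> real d * ln (real d * real M)"
    if xy: "(xs, ys) \<in> D" for xs ys
  proof -
    let ?A = "P xs - P ys"
    have B': "xs \<in> B" "ys \<in> B" "xs \<noteq> ys" using xy by (auto simp: D_def)
    have coeff: "\<bar>coeff ?A i\<bar> \<le> int M" for i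
    proof (cases "i < d")
      case True
      then have "xs ! i < M" "ys ! i < M" using B' by (auto simp: B_def subset_iff)
      then show ?thesis using coeffP B' True by simp
    qed (use coeffP B' in simp)
    have "degree ?A < d"
    proof -
      have "degree ?A \<le> d - 1" using coeffP B' by (intro degree_le) auto
      then show ?thesis using d by linarith
    qed
    have "?A \<noteq> 0"
    proof
      assume "?A = 0"
      then have "coeff (P xs) i = coeff (P ys) i" for i by simp
      then have "xs ! i = ys ! i" if "i < d" for i using coeffP B' that by (metis of_nat_eq_iff)
      then have "xs = ys" using B' by (intro nth_equalityI) (auto simp: B_def)
      then show False using B' by simp
    qed
    \<comment> \<open>A vanishing norm would make a polynomial of degree \<open>d\<close> divide a
      nonzero one of smaller degree.\<close>
    have nz: "nrm ?A \<noteq> 0"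
    proof
      assume "nrm ?A = 0"
      then have "monom 1 d + 1 dvd ?A" by (rule nrm)
      then have "degree (monom 1 d + 1 :: int poly) \<le> degree ?A"
        using \<open>?A \<noteq> 0\<close> by (rule dvd_imp_degree_le)
      then show False using \<open>degree ?A < d\<close> lead_coeff_monom_add_one(1)[of d] d by simp
    qed
    have "int p ^ K p ?A dvd nrm ?A" if "p \<in> Q" for p
    proof -
      let ?pr = "\<Prod>j<d. poly ?A (r p ^ (2 * j + 1))"
      have "K p ?A \<le> card {..<d}" unfolding K_def by (rule card_mono) auto
      then have "int p ^ K p ?A dvd int p ^ d" by (simp add: le_imp_power_dvd)
      moreover have "[nrm ?A = ?pr] (mod int p ^ d)" by (rule nrm(3)[OF r[OF that]])
      ultimately have "[nrm ?A = ?pr] (mod int p ^ K p ?A)" by (rule cong_dvd_modulus[rotated])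
      moreover have "int p ^ K p ?A dvd ?pr"
        unfolding K_def by (rule prime_power_card_dvd_prod) simp
      ultimately show ?thesis by (simp add: cong_dvd_iff)
    qed
    then have "(\<Prod>p\<in>Q. int p ^ K p ?A) dvd nrm ?A"
      using \<open>finite Q\<close> Q(1) by (intro prod_prime_powers_dvd)
    then have "(\<Prod>p\<in>Q. int p ^ K p ?A) \<le> \<bar>nrm ?A\<bar>"
      using nz by (rule dvd_imp_le_int[rotated, THEN order_trans[OF abs_ge_self]])
    also have "\<dots> \<le> coeff_norm ?A ^ d" by (rule nrm(1))
    also have "\<dots> \<le> (int d * int M) ^ d"
      using coeff_norm_le[OF \<open>degree ?A < d\<close> coeff] coeff_norm_nonneg by (intro power_mono)
    finally have "real_of_int (\<Prod>p\<in>Q. int p ^ K p ?A) \<le> real_of_int ((int d * int M) ^ d)"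
      by (simp only: of_int_le_iff)
    then have le: "(\<Prod>p\<in>Q. real p ^ K p ?A) \<le> (real d * real M) ^ d" by simp
    have pos: "real p > 0" if "p \<in> Q" for p using Q(1)[OF that] by (simp add: prime_gt_0_nat)
    have "(\<Sum>p\<in>Q. real (K p ?A) * ln (real p)) = (\<Sum>p\<in>Q. ln (real p ^ K p ?A))"
      using pos by (intro sum.cong) (auto simp: ln_realpow)
    also have "\<dots> = ln (\<Prod>p\<in>Q. real p ^ K p ?A)"
      using pos \<open>finite Q\<close> by (intro ln_prod[symmetric]) auto
    also have "\<dots> \<le> ln ((real d * real M) ^ d)"
      using pos by (intro ln_mono le prod_pos) auto
    also have "\<dots> = real d * ln (real d * real M)" using d M by (simp add: ln_realpow)
    finally show ?thesis .
  qed
  \<comment> \<open>The \<open>M ^ d\<close> vectors fall into \<open>p\<close> residue classes,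
    giving at least W^2 / p colliding pairs with W = \<open>M ^ d\<close>. The subtracted W accounts
    for the diagonal, on which the norm would vanish.\<close>
  have collisions: "real (M ^ d) ^ 2 / real p - real (M ^ d) \<le>
      real (card {z \<in> D. int p dvd poly (P (fst z) - P (snd z)) x})" if p: "p \<in> Q" for p x
  proof -
    define g where "g xs = poly (P xs) x mod int p" for xs
    let ?E = "{z \<in> D. int p dvd poly (P (fst z) - P (snd z)) x}"
    have p0: "p > 0" using Q(1)[OF p] by (rule prime_gt_0_nat)
    have "real (card B) ^ 2 \<le> real (card {0..<int p}) * real (card {(xs, ys) \<in> B \<times> B. g xs = g ys})"
      using B p0 by (intro card_collisions_ge) (auto simp: g_def)
    then have *: "real (M ^ d) ^ 2 \<le> real p * real (card {(xs, ys) \<in> B \<times> B. g xs = g ys})"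
      using B by simp
    have "{(xs, ys) \<in> B \<times> B. g xs = g ys} \<subseteq> ?E \<union> (\<lambda>xs. (xs, xs)) ` B"
      by (auto simp: D_def g_def mod_eq_dvd_iff)
    then have "card {(xs, ys) \<in> B \<times> B. g xs = g ys} \<le> card (?E \<union> (\<lambda>xs. (xs, xs)) ` B)"
      using B D by (intro card_mono) (auto intro: finite_subset[of _ D])
    also have "\<dots> \<le> card ?E + card ((\<lambda>xs. (xs, xs)) ` B)" by (rule card_Un_le)
    also have "card ((\<lambda>xs. (xs, xs)) ` B) \<le> M ^ d" using card_image_le[OF B(1)] B(2) by metis
    finally have "real (card {(xs, ys) \<in> B \<times> B. g xs = g ys}) \<le> real (card ?E) + real (M ^ d)" by linarith
    then have "real p * real (card {(xs, ys) \<in> B \<times> B. g xs = g ys}) \<le> real p * (real (card ?E) + real (M ^ d))"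
      by (intro mult_left_mono) auto
    with * have "real (M ^ d) ^ 2 \<le> real p * (real (card ?E) + real (M ^ d))" by linarith
    then show ?thesis using p0 by (simp add: field_simps)
  qed
  define W where "W = real (M ^ d)"
  have W: "W > 0" using M by (simp add: W_def)
  have sumK: "(\<Sum>(xs, ys)\<in>D. real (K p (P xs - P ys))) \<ge> real d * (W\<^sup>2 / real p - W)" if p: "p \<in> Q" for p
  proof -
    have "real d * (W\<^sup>2 / real p - W) = (\<Sum>j<d. W\<^sup>2 / real p - W)" by simp
    also have "\<dots> \<le> (\<Sum>j<d. real (card {z \<in> D. int p dvd poly (P (fst z) - P (snd z)) (r p ^ (2 * j + 1))}))"
      unfolding W_def by (intro sum_mono collisions p)
    also have "\<dots> = (\<Sum>j<d. \<Sum>z\<in>D. if int p dvd poly (P (fst z) - P (snd z)) (r p ^ (2 * j + 1)) then 1 else 0)"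
      by (intro sum.cong refl) (simp only: case_prod_beta real_card_filter[OF D(1)])
    also have "\<dots> = (\<Sum>z\<in>D. \<Sum>j<d. if int p dvd poly (P (fst z) - P (snd z)) (r p ^ (2 * j + 1)) then 1 else 0)"
      by (rule sum.swap)
    also have "\<dots> = (\<Sum>(xs, ys)\<in>D. real (K p (P xs - P ys)))"
      by (intro sum.cong refl) (simp only: K_def case_prod_beta real_card_filter[OF finite_lessThan])
    finally show ?thesis .
  qed
  have ln_pos: "ln (real p) \<ge> 0" if "p \<in> Q" for p
    using prime_ge_1_nat[OF Q(1)[OF that]] by simp
  \<comment> \<open>The diagonal correction costs W times this sum in total. As all primes are at
    most \<open>M ^ d\<close>, that is W, Chebyshev's bound keeps the cost at order W^2, comparable
    to the number of pairs.\<close>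
  have "(\<Sum>p\<in>Q. ln (real p)) \<le> (\<Sum>p | prime p \<and> p \<le> M ^ d. ln (real p))"
  proof (rule sum_mono2)
    show "Q \<subseteq> {p. prime p \<and> p \<le> M ^ d}" using Q(1,3) by (auto simp: d_def)
    show "0 \<le> ln (real p)" if "p \<in> {p. prime p \<and> p \<le> M ^ d} - Q" for p
      using prime_ge_1_nat[of p] that by auto
  qed auto
  also have "\<dots> \<le> W * ln 4" unfolding W_def by (rule sum_ln_primes_le)
  finally have theta: "(\<Sum>p\<in>Q. ln (real p)) \<le> W * ln 4" .
  have dM: "ln (real d * real M) \<ge> 0"
  proof -
    have "1 * 1 \<le> real d * real M" using d M by (intro mult_mono) auto
    then show ?thesis by simp
  qed
  have "(\<Sum>p\<in>Q. real d * (W\<^sup>2 / real p - W) * ln (real p)) \<le>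
      (\<Sum>p\<in>Q. (\<Sum>(xs, ys)\<in>D. real (K p (P xs - P ys))) * ln (real p))"
    by (intro sum_mono mult_right_mono sumK ln_pos)
  also have "\<dots> = (\<Sum>p\<in>Q. \<Sum>z\<in>D. real (K p (P (fst z) - P (snd z))) * ln (real p))"
    by (simp add: sum_distrib_right case_prod_beta)
  also have "\<dots> = (\<Sum>z\<in>D. \<Sum>p\<in>Q. real (K p (P (fst z) - P (snd z))) * ln (real p))"
    by (rule sum.swap)
  also have "\<dots> \<le> (\<Sum>z\<in>D. real d * ln (real d * real M))"
    by (rule sum_mono) (use log_bound in force)
  also have "\<dots> = real (card D) * (real d * ln (real d * real M))" by simp
  also have "\<dots> \<le> W\<^sup>2 * (real d * ln (real d * real M))"
  proof (rule mult_right_mono)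
    have "real (card D) \<le> real (M ^ d * M ^ d)" using D(2) by (rule of_nat_mono)
    then show "real (card D) \<le> W\<^sup>2" by (simp add: W_def power2_eq_square)
  qed (use dM in simp)
  also have "(\<Sum>p\<in>Q. real d * (W\<^sup>2 / real p - W) * ln (real p)) =
      real d * (W\<^sup>2 * (\<Sum>p\<in>Q. ln (real p) / real p) - W * (\<Sum>p\<in>Q. ln (real p)))"
    by (simp add: sum_distrib_left sum_subtractf algebra_simps)
  finally have "real d * (W\<^sup>2 * (\<Sum>p\<in>Q. ln (real p) / real p) - W * (\<Sum>p\<in>Q. ln (real p)))
      \<le> real d * (W\<^sup>2 * ln (real d * real M))" by (simp add: algebra_simps)
  then have "W\<^sup>2 * (\<Sum>p\<in>Q. ln (real p) / real p) - W * (\<Sum>p\<in>Q. ln (real p)) \<le> W\<^sup>2 * ln (real d * real M)"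
    using d by simp
  moreover have "W * (\<Sum>p\<in>Q. ln (real p)) \<le> W\<^sup>2 * ln 4"
    using mult_left_mono[OF theta, of W] W by (simp add: power2_eq_square mult.assoc)
  ultimately have "W\<^sup>2 * (\<Sum>p\<in>Q. ln (real p) / real p) \<le> W\<^sup>2 * (ln (real d * real M) + ln 4)"
    by (simp add: algebra_simps)
  then have "(\<Sum>p\<in>Q. ln (real p) / real p) \<le> ln (real d * real M) + ln 4" using W by simp
  also have "ln (real d * real M) = ln (2 ^ k) + ln (real M)"
    using M by (simp add: d_def ln_mult)
  finally show ?thesis by simp
qed

section \<open>The product of the values\<close>

text \<open>A lower Stirling bound: from n to n + 1 the left side grows by at most ln (n + 1),
  because n (ln (n + 1) - ln n) \<le> 1.\<close>

lemma sum_ln_ge: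
  assumes "N \<ge> 1"
  shows "real N * ln (real N) - real N \<le> (\<Sum>n=1..N. ln (real n))"
  using assms
proof (induction N rule: dec_induct)
  case (step n)
  have "ln (real (Suc n)) - ln (real n) = ln (real (Suc n) / real n)"
    using step.hyps by (simp add: ln_div)
  also have "\<dots> \<le> real (Suc n) / real n - 1" using step.hyps by (intro ln_le_minus_one) auto
  also have "\<dots> = 1 / real n" using step.hyps by (simp add: field_simps)
  finally have "real n * (ln (real (Suc n)) - ln (real n)) \<le> real n * (1 / real n)"
    by (intro mult_left_mono) auto
  then have "real n * (ln (real (Suc n)) - ln (real n)) \<le> 1" using step.hyps by simp
  then show ?case using step.IH by (simp add: algebra_simps)
qed auto

section \<open>The primes dividing the values\<close>

definition value_primes :: "nat \<Rightarrow> nat \<Rightarrow> nat set" where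
  "value_primes k N = {p. prime p \<and> (\<exists>n\<in>{1..N}. p dvd n ^ 2 ^ k + 1)}"

lemma value_primes_eq: "value_primes k N = (\<Union>n\<in>{1..N}. prime_factors (n ^ 2 ^ k + 1))"
  by (auto simp: value_primes_def prime_factors_dvd simp del: One_nat_def)

lemma finite_value_primes [simp]: "finite (value_primes k N)"
  unfolding value_primes_eq by simp

text \<open>The least common multiple divides the product of the values and is divisible by each of
  them, so its prime factors are exactly the primes dividing some value.\<close>

lemma ln_ell_eq:
  "ln (real_of_int (ell (monom 1 (2 ^ k) + 1) N)) = (\<Sum>p\<in>value_primes k N. ln (real p))"
proof -
  define L where "L = Lcm ((\<lambda>n. poly (monom 1 (2 ^ k) + 1) (int n)) ` {1..N})"
  have val: "poly (monom 1 (2 ^ k) + 1) (int n) = int (n ^ 2 ^ k + 1)" for n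
    by (simp add: poly_monom)
  have "L \<noteq> 0" unfolding L_def val by (subst Lcm_0_iff) (auto simp del: of_nat_add of_nat_Suc)
  have dvd: "p dvd L \<longleftrightarrow> (\<exists>n\<in>{1..N}. p dvd int (n ^ 2 ^ k + 1))" if "prime p" for p
  proof
    have "L dvd (\<Prod>n\<in>{1..N}. int (n ^ 2 ^ k + 1))"
      unfolding L_def val by (intro Lcm_least) (auto intro!: dvd_prodI simp del: of_nat_add)
    moreover assume "p dvd L"
    ultimately have "p dvd (\<Prod>n\<in>{1..N}. int (n ^ 2 ^ k + 1))" by (rule dvd_trans[rotated])
    then show "\<exists>n\<in>{1..N}. p dvd int (n ^ 2 ^ k + 1)" using that by (simp only: prime_dvd_prod_iff finite_atLeastAtMost)
  next
    assume "\<exists>n\<in>{1..N}. p dvd int (n ^ 2 ^ k + 1)"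
    then show "p dvd L" unfolding L_def val by (auto intro!: dvd_trans[OF _ dvd_Lcm] simp del: of_nat_add)
  qed
  have "prime_factors L = int ` value_primes k N"
  proof (intro set_eqI iffI)
    fix q assume "q \<in> prime_factors L"
    then have q: "prime q" "q dvd L" by (auto simp: in_prime_factors_iff)
    then obtain p where p: "q = int p" by (metis prime_ge_0_int nonneg_int_cases)
    obtain n where "n \<in> {1..N}" "q dvd int (n ^ 2 ^ k + 1)" using q dvd[of q] by auto
    then have "p \<in> value_primes k N"
      using q(1) unfolding value_primes_def p of_nat_dvd_iff prime_int_nat_transfer by auto
    then show "q \<in> int ` value_primes k N" unfolding p by (rule imageI)
  next
    fix q assume "q \<in> int ` value_primes k N"
    then obtain p n where p: "q = int p" "prime p" "n \<in> {1..N}" "p dvd n ^ 2 ^ k + 1"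
      by (auto simp: value_primes_def)
    then have "int p dvd int (n ^ 2 ^ k + 1)" by (simp only: of_nat_dvd_iff)
    then show "q \<in> prime_factors L"
      using p dvd[of q] \<open>L \<noteq> 0\<close> by (auto simp: in_prime_factors_iff)
  qed
  then have "ell (monom 1 (2 ^ k) + 1) N = (\<Prod>p\<in>value_primes k N. int p)"
    unfolding ell_def rad_def L_def[symmetric] by (simp add: prod.reindex)
  then have "real_of_int (ell (monom 1 (2 ^ k) + 1) N) = (\<Prod>p\<in>value_primes k N. real p)" by simp
  then show ?thesis
    by (simp only:) (rule ln_prod, auto simp: value_primes_def prime_gt_0_nat)
qed

lemma sum_ln_values_eq:
  "(\<Sum>n=1..N. ln (real (n ^ 2 ^ k + 1))) =
    (\<Sum>p\<in>value_primes k N. real (\<Sum>n=1..N. multiplicity p (n ^ 2 ^ k + 1)) * ln (real p))"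
proof -
  have "ln (real (n ^ 2 ^ k + 1)) =
      (\<Sum>p\<in>value_primes k N. real (multiplicity p (n ^ 2 ^ k + 1)) * ln (real p))" if n: "n \<in> {1..N}" for n
  proof -
    define m where "m = n ^ 2 ^ k + 1"
    have m: "m > 0" by (simp add: m_def)
    have pos: "real p > 0" if "p \<in> prime_factors m" for p
      using that by (auto simp: in_prime_factors_iff prime_gt_0_nat)
    have "real (\<Prod>p\<in>prime_factors m. p ^ multiplicity p m) = real m"
      using prod_prime_factors[of m] m by (simp del: of_nat_prod)
    then have "real m = (\<Prod>p\<in>prime_factors m. real p ^ multiplicity p m)" by simp
    then have "ln (real m) = (\<Sum>p\<in>prime_factors m. ln (real p ^ multiplicity p m))"
      by (simp only:) (rule ln_prod, use pos in auto)
    also have "\<dots> = (\<Sum>p\<in>prime_factors m. real (multiplicity p m) * ln (real p))"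
      using pos by (intro sum.cong) (auto simp: ln_realpow)
    also have "\<dots> = (\<Sum>p\<in>value_primes k N. real (multiplicity p m) * ln (real p))"
    proof (rule sum.mono_neutral_left)
      show "prime_factors m \<subseteq> value_primes k N" using n unfolding value_primes_eq m_def by blast
      show "\<forall>p\<in>value_primes k N - prime_factors m. real (multiplicity p m) * ln (real p) = 0"
        using m by (auto simp: value_primes_def in_prime_factors_iff not_dvd_imp_multiplicity_0)
    qed simp
    finally show ?thesis by (simp only: m_def)
  qed
  then have "(\<Sum>n=1..N. ln (real (n ^ 2 ^ k + 1))) =
      (\<Sum>n=1..N. \<Sum>p\<in>value_primes k N. real (multiplicity p (n ^ 2 ^ k + 1)) * ln (real p))"
    by (rule sum.cong[OF refl])
  also have "\<dots> = (\<Sum>p\<in>value_primes k N. \<Sum>n=1..N. real (multiplicity p (n ^ 2 ^ k + 1)) * ln (real p))"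
    by (rule sum.swap)
  finally show ?thesis by (simp only: sum_distrib_right of_nat_sum)
qed

section \<open>The contribution of the primes up to 2 N\<close>

lemma multiplicity_two_le:
  assumes "k \<ge> 1"
  shows "multiplicity 2 (n ^ 2 ^ k + 1 :: nat) \<le> 1"
proof -
  have "\<not> 4 dvd n ^ 2 ^ k + 1"
  proof
    assume 4: "4 dvd n ^ 2 ^ k + 1"
    \<comment> \<open>As \<open>k \<ge> 1\<close>, the power is the square of \<open>x\<close>.
      Squares are 0 or 1 modulo 4, so the value is 1 or 2 modulo 4.\<close>
    define x where "x = n ^ 2 ^ (k - 1)"
    have "n ^ 2 ^ k = x ^ 2"
      using assms unfolding x_def power_mult[symmetric] by (simp add: power_Suc2[symmetric] del: power_Suc power_Suc2)
    then have "(x\<^sup>2 + 1) mod 4 = 0" using 4 by simp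
    moreover have "x mod 4 = 0 \<or> x mod 4 = 1 \<or> x mod 4 = 2 \<or> x mod 4 = 3" by linarith
    then have "x\<^sup>2 mod 4 = 0 \<or> x\<^sup>2 mod 4 = 1"
      unfolding power_mod[of x 4 2, symmetric] by (elim disjE) simp_all
    ultimately show False by (auto simp: mod_Suc)
  qed
  then have "\<not> 2 ^ 2 dvd n ^ 2 ^ k + 1" by simp
  then have "\<not> 2 \<le> multiplicity 2 (n ^ 2 ^ k + 1)" by (meson multiplicity_dvd')
  then show ?thesis by simp
qed

lemma sum_inverse_powers_le:
  fixes x :: real
  assumes "x > 1"
  shows "(\<Sum>e=1..E. 1 / x ^ e) \<le> 1 / (x - 1)"
proof -
  have "(\<Sum>e=1..E. 1 / x ^ e) = (1 - 1 / x ^ E) / (x - 1)"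
  proof (induction E)
    case (Suc E)
    have "(\<Sum>e=1..Suc E. 1 / x ^ e) = (1 - 1 / x ^ E) / (x - 1) + 1 / x ^ Suc E" using Suc by simp
    also have "\<dots> = (1 - 1 / x ^ Suc E) / (x - 1)" using assms by (simp add: field_simps)
    finally show ?case .
  qed simp
  also have "\<dots> \<le> 1 / (x - 1)" using assms by (intro divide_right_mono) auto
  finally show ?thesis .
qed

text \<open>The root counts are summed over e: the terms N / p^e form a geometric series bounded by
  N / (p - 1), and the remaining ones cost \<open>E\<close> times ln p, at most the logarithm of the
  largest value. Writing 1 / (p - 1) as 1 / p + 1 / (p (p - 1)) separates the Mertens sum from a
  convergent series.\<close>

lemma sum_multiplicity_small_prime_le:
  fixes p N k :: nat
  assumes p: "prime p" "odd p"
  shows "real (\<Sum>n=1..N. multiplicity p (n ^ 2 ^ k + 1)) * ln (real p) \<le>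
    2 ^ k * (real N * (ln (real p) / real p + ln (real p) / (real p * (real p - 1))) + ln (real (N ^ 2 ^ k + 1)))"
proof -
  have p1: "real p > 1" using prime_gt_1_nat[OF p(1)] by simp
  obtain E where E: "p ^ E \<le> N ^ 2 ^ k + 1" "N ^ 2 ^ k + 1 < p ^ (E + 1)"
    using ex_power_ivl1[of p "N ^ 2 ^ k + 1"] prime_ge_2_nat[OF p(1)] by auto
  have "real (\<Sum>n=1..N. multiplicity p (n ^ 2 ^ k + 1)) = (\<Sum>e=1..E. real (card (root_set k N (p ^ e))))"
    using sum_multiplicity_eq[OF p(1), of N k E] E by simp
  also have "\<dots> \<le> (\<Sum>e=1..E. 2 ^ k * (real N * (1 / real p ^ e) + 1))"
  proof (rule sum_mono)
    fix e assume "e \<in> {1..E}"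
    then have "real (card (root_set k N (p ^ e))) \<le> real (2 ^ k * (N div p ^ e + 1))"
      using p by (intro of_nat_mono card_root_set_le) auto
    also have "\<dots> = 2 ^ k * (real (N div p ^ e) + 1)"
      by (simp only: of_nat_mult of_nat_add of_nat_power of_nat_numeral of_nat_1)
    also have "real (N div p ^ e) \<le> real N / real (p ^ e)" by (rule of_nat_div_le_of_nat)
    finally show "real (card (root_set k N (p ^ e))) \<le> 2 ^ k * (real N * (1 / real p ^ e) + 1)"
      by (simp add: distrib_left)
  qed
  also have "\<dots> = 2 ^ k * (real N * (\<Sum>e=1..E. 1 / real p ^ e) + real E)"
    by (simp only: sum.distrib sum_distrib_left[symmetric]) simp
  also have "\<dots> \<le> 2 ^ k * (real N * (1 / (real p - 1)) + real E)"
    by (intro mult_left_mono add_mono sum_inverse_powers_le p1) auto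
  finally have "real (\<Sum>n=1..N. multiplicity p (n ^ 2 ^ k + 1)) * ln (real p) \<le>
      2 ^ k * (real N * (1 / (real p - 1)) + real E) * ln (real p)"
    using p1 by (intro mult_right_mono) auto
  also have "\<dots> = 2 ^ k * (real N * (ln (real p) / (real p - 1)) + ln (real (p ^ E)))"
    using p1 by (simp add: ln_realpow algebra_simps)
  also have "\<dots> \<le> 2 ^ k * (real N * (ln (real p) / (real p - 1)) + ln (real (N ^ 2 ^ k + 1)))"
    using p1 E(1) prime_gt_0_nat[OF p(1)]
    by (intro mult_left_mono add_left_mono ln_mono of_nat_mono) auto
  also have "ln (real p) / (real p - 1) = ln (real p) / real p + ln (real p) / (real p * (real p - 1))"
    using p1 by (simp add: field_simps)
  finally show ?thesis .
qed

text \<open>For the least \<open>M\<close> with \<open>x \<le> M ^ d\<close> the power of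
  \<open>M - 1\<close> is still below \<open>x\<close>, and \<open>M \<le> 2 * (M - 1)\<close> costs
  only d ln 2.\<close>

lemma exists_power_bracket:
  fixes x d :: nat
  assumes "d > 0" "x > 1"
  obtains M :: nat where "M \<ge> 1" "x \<le> M ^ d" "real d * ln (real M) \<le> ln (real x) + real d * ln 2"
proof -
  define M where "M = (LEAST M. x \<le> M ^ d)"
  have "x \<le> x ^ d" using assms by (simp add: self_le_power)
  then have M: "x \<le> M ^ d" unfolding M_def by (rule LeastI)
  have "M \<noteq> 0" "M \<noteq> 1" using M assms by (auto intro: ccontr simp: zero_power)
  then have M2: "M \<ge> 2" by simp
  have "(M - 1) ^ d < x"
    using not_less_Least[of "M - 1" "\<lambda>M. x \<le> M ^ d"] M2 by (simp add: M_def[symmetric])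
  then have "real ((M - 1) ^ d) \<le> real x" by simp
  then have "real (M - 1) ^ d \<le> real x" by simp
  have "real d * ln (real M) \<le> real d * ln (2 * real (M - 1))"
    using M2 by (intro mult_left_mono ln_mono) auto
  also have "\<dots> = real d * ln 2 + ln (real (M - 1) ^ d)"
    using ln_mult_pos[of 2 "real (M - 1)"] M2 by (simp add: ln_realpow distrib_left del: of_nat_diff)
  also have "\<dots> \<le> real d * ln 2 + ln (real x)"
    using M2 \<open>real (M - 1) ^ d \<le> real x\<close> by (intro add_left_mono ln_mono) auto
  finally show ?thesis using M2 by (intro that[of M] M) auto
qed

lemma sum_small_primes_le:
  assumes k: "k \<ge> 1"
  obtains C :: real where "\<And>N. N \<ge> 2 \<Longrightarrow>
    (\<Sum>p | p \<in> value_primes k N \<and> p \<le> 2 * N. real (\<Sum>n=1..N. multiplicity p (n ^ 2 ^ k + 1)) * ln (real p))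
      \<le> real N * ln (real N) + C * real N"
proof -
  define d :: nat where "d = 2 ^ k"
  have d: "d > 0" "real d = 2 ^ k" by (auto simp: d_def)
  \<comment> \<open>The first \<open>ln 2\<close> pays for the prime 2. The bracket collects ln (2
    N) - ln N, the loss in choosing \<open>M\<close> and the constants of the Mertens bound. Then
    come the convergent series and, by Chebyshev at 2 N, the logarithms of the largest
    value.\<close>
  define C :: real where
    "C = ln 2 + (ln 2 + real d * ln 2 + real d * (ln (real d) + ln 4)) + 2 * real d + 2 * real d * real d * (2 + 2 * ln 4)"
  have "(\<Sum>p | p \<in> value_primes k N \<and> p \<le> 2 * N. real (\<Sum>n=1..N. multiplicity p (n ^ 2 ^ k + 1)) * ln (real p))
      \<le> real N * ln (real N) + C * real N" if N: "N \<ge> 2" for N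
  proof -
    define v where "v p = real (\<Sum>n=1..N. multiplicity p (n ^ 2 ^ k + 1)) * ln (real p)" for p
    define A where "A = {p \<in> value_primes k N. p \<le> 2 * N \<and> odd p}"
    have A: "finite A" by (simp add: A_def)
    have primeA: "prime p" "odd p" "p \<le> 2 * N" if "p \<in> A" for p
      using that by (auto simp: A_def value_primes_def)
    have v_nonneg: "v p \<ge> 0" if "prime p" for p
      using prime_ge_1_nat[OF that] by (simp add: v_def sum_nonneg)
    have "{p. p \<in> value_primes k N \<and> p \<le> 2 * N} \<subseteq> insert 2 A"
    proof
      fix p assume p: "p \<in> {p. p \<in> value_primes k N \<and> p \<le> 2 * N}"
      then have "prime p" by (simp add: value_primes_def)
      then have "p = 2 \<or> odd p" using prime_odd_nat[of p] prime_ge_2_nat[of p] by linarith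
      then show "p \<in> insert 2 A" using p by (auto simp: A_def)
    qed
    then have "(\<Sum>p | p \<in> value_primes k N \<and> p \<le> 2 * N. v p) \<le> (\<Sum>p\<in>insert 2 A. v p)"
      using A primeA(1) v_nonneg by (intro sum_mono2) auto
    also have "\<dots> = v 2 + (\<Sum>p\<in>A. v p)" using A primeA(2)[of 2] by (subst sum.insert) auto
    finally have split: "(\<Sum>p | p \<in> value_primes k N \<and> p \<le> 2 * N. v p) \<le> v 2 + (\<Sum>p\<in>A. v p)" .
    have "(\<Sum>n=1..N. multiplicity 2 (n ^ 2 ^ k + 1)) \<le> (\<Sum>n=1..N. 1::nat)"
      by (intro sum_mono multiplicity_two_le k)
    then have "real (\<Sum>n=1..N. multiplicity 2 (n ^ 2 ^ k + 1)) \<le> real N"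
      by (intro of_nat_mono) simp
    then have v2: "v 2 \<le> real N * ln 2" unfolding v_def by (simp add: mult_right_mono)
    have "2 * N > 1" using N by simp
    \<comment> \<open>\<open>M ^ d\<close> must reach 2 N to cover all primes in \<open>A\<close>,
      while d ln M may exceed ln (2 N) only by a constant. This yields the coefficient 1 of N ln
      N.\<close>
    then obtain M :: nat where M: "M \<ge> 1" "2 * N \<le> M ^ d"
        "real d * ln (real M) \<le> ln (real (2 * N)) + real d * ln 2"
      by (rule exists_power_bracket[OF d(1)])
    have "(\<Sum>p\<in>A. v p) \<le> (\<Sum>p\<in>A. real d * (real N * (ln (real p) / real p +
        ln (real p) / (real p * (real p - 1))) + ln (real (N ^ d + 1))))"
      unfolding v_def d(2) using sum_multiplicity_small_prime_le primeA
      by (intro sum_mono) (simp add: d_def)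
    also have "\<dots> = real d * (real N * ((\<Sum>p\<in>A. ln (real p) / real p) +
        (\<Sum>p\<in>A. ln (real p) / (real p * (real p - 1)))) + real (card A) * ln (real (N ^ d + 1)))"
      by (simp add: sum.distrib sum_distrib_left[symmetric])
    also have "\<dots> \<le> real d * (real N * ((ln (real M) + ln (real d) + ln 4) + 2) +
        real d * ((2 + 2 * ln 4) * real (2 * N)))"
    proof (intro mult_left_mono add_mono)
      show "(\<Sum>p\<in>A. ln (real p) / real p) \<le> ln (real M) + ln (real d) + ln 4"
        unfolding d(2)
      proof (rule sum_ln_div_root_primes_le[OF M(1) A])
        show "p \<le> M ^ 2 ^ k" if "p \<in> A" for p
          using primeA(3)[OF that] M(2) by (simp add: d_def)
        show "\<exists>r. int p dvd r ^ 2 ^ k + 1" if "p \<in> A" for p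
        proof -
          obtain n where "p dvd n ^ 2 ^ k + 1" using \<open>p \<in> A\<close> by (auto simp: A_def value_primes_def)
          then have "int p dvd int (n ^ 2 ^ k + 1)" by (simp only: of_nat_dvd_iff)
          then show ?thesis by (intro exI[of _ "int n"]) (simp add: add.commute)
        qed
      qed (use primeA in auto)
      have "(\<Sum>p\<in>A. ln (real p) / (real p * (real p - 1))) \<le> (\<Sum>p=2..2 * N. ln (real p) / (real p * (real p - 1)))"
        using primeA prime_ge_2_nat by (intro sum_mono2) auto
      also have "\<dots> \<le> 2" by (rule sum_ln_div_le)
      finally show "(\<Sum>p\<in>A. ln (real p) / (real p * (real p - 1))) \<le> 2" .
      have "N ^ d + 1 \<le> (2 * N) ^ d"
      proof -
        have "N ^ d + 1 \<le> N ^ d + N ^ d" using N by simp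
        also have "\<dots> \<le> 2 ^ d * N ^ d" using self_le_power[of "2::nat" d] d by (simp flip: mult_2)
        finally show ?thesis by (simp add: power_mult_distrib)
      qed
      then have "real (N ^ d + 1) \<le> real (2 * N) ^ d" by (simp only: of_nat_le_iff flip: of_nat_power)
      moreover have "real (N ^ d + 1) > 0" by (simp only: of_nat_0_less_iff)
      ultimately have "ln (real (N ^ d + 1)) \<le> ln (real (2 * N) ^ d)" by (intro ln_mono)
      also have "\<dots> = real d * ln (real (2 * N))" by (rule ln_realpow)
      finally have "real (card A) * ln (real (N ^ d + 1)) \<le> real (card A) * (real d * ln (real (2 * N)))"
        by (intro mult_left_mono) auto
      also have "\<dots> = real d * (real (card A) * ln (real (2 * N)))" by simp
      also have "\<dots> \<le> real d * (real (card {p. prime p \<and> p \<le> 2 * N}) * ln (real (2 * N)))"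
        using N primeA by (intro mult_left_mono mult_right_mono of_nat_mono card_mono) auto
      also have "\<dots> \<le> real d * ((2 + 2 * ln 4) * real (2 * N))"
        using N by (intro mult_left_mono card_primes_mult_ln_le) auto
      finally show "real (card A) * ln (real (N ^ d + 1)) \<le> real d * ((2 + 2 * ln 4) * real (2 * N))" .
    qed auto
    also have "\<dots> = real N * (real d * ln (real M)) + real N * (real d * (ln (real d) + ln 4) + 2 * real d +
        2 * real d * real d * (2 + 2 * ln 4))"
      by (simp add: algebra_simps)
    also have "\<dots> \<le> real N * (ln (real (2 * N)) + real d * ln 2) + real N * (real d * (ln (real d) + ln 4) + 2 * real d +
        2 * real d * real d * (2 + 2 * ln 4))"
      using M(3) by (intro add_right_mono mult_left_mono) auto
    finally have "(\<Sum>p\<in>A. v p) \<le> real N * (ln (real (2 * N)) + real d * ln 2) +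
        real N * (real d * (ln (real d) + ln 4) + 2 * real d + 2 * real d * real d * (2 + 2 * ln 4))" .
    moreover have "ln (real (2 * N)) = ln 2 + ln (real N)" using N by (simp add: ln_mult)
    ultimately have "v 2 + (\<Sum>p\<in>A. v p) \<le> real N * ln (real N) + C * real N"
      using v2 by (simp add: C_def algebra_simps)
    with split show ?thesis unfolding v_def by linarith
  qed
  then show ?thesis using that by blast
qed

section \<open>Comparing the size of the product with its prime factorization\<close>

theorem theorem1p4:
  fixes \<eta> :: nat and f :: "int poly"
  assumes "\<eta> \<ge> 1" and "f = monom 1 (2 ^ \<eta>) + 1"
  shows "\<exists>C::real. C > 0 \<and> (\<forall>N::nat. N \<ge> 2 \<longrightarrow>
    ln (real_of_int (ell f N))
      \<ge> (2 ^ \<eta> - 1) / (real \<eta> * 2 ^ (\<eta> - 1)) * real N * ln (real N) - C * real N)"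
proof -
  obtain C0 where C0: "\<And>N. N \<ge> 2 \<Longrightarrow>
    (\<Sum>p | p \<in> value_primes \<eta> N \<and> p \<le> 2 * N. real (\<Sum>n=1..N. multiplicity p (n ^ 2 ^ \<eta> + 1)) * ln (real p))
      \<le> real N * ln (real N) + C0 * real N"
    by (rule sum_small_primes_le[OF assms(1)]) blast
  \<comment> \<open>\<open>K\<close> is the multiplicity bound for primes above 2 N; dividing by it
    at the end produces the denominator of the leading coefficient.\<close>
  define d K :: real where "d = 2 ^ \<eta>" and "K = real \<eta> * 2 ^ (\<eta> - 1)"
  have K: "K > 0" using assms(1) by (simp add: K_def)
  \<comment> \<open>The absolute value is taken because \<open>C0\<close> has no known sign;
    \<open>d\<close> is the loss in the Stirling bound.\<close>
  define C where "C = (\<bar>C0\<bar> + d) / K"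
  have "C > 0" using K by (simp add: C_def d_def add_nonneg_pos)
  moreover have "ln (real_of_int (ell f N)) \<ge> (d - 1) / K * real N * ln (real N) - C * real N"
    if N: "N \<ge> 2" for N
  proof -
    define v where "v p = real (\<Sum>n=1..N. multiplicity p (n ^ 2 ^ \<eta> + 1)) * ln (real p)" for p
    define V where "V = value_primes \<eta> N"
    have V: "finite V" "\<And>p. p \<in> V \<Longrightarrow> prime p" by (auto simp: V_def value_primes_def)
    have ln_nonneg: "ln (real p) \<ge> 0" if "p \<in> V" for p
      using prime_ge_1_nat[OF V(2)[OF that]] by simp
    have "d * (real N * ln (real N) - real N) \<le> d * (\<Sum>n=1..N. ln (real n))"
      using N by (intro mult_left_mono sum_ln_ge) (auto simp: d_def)
    also have "\<dots> = (\<Sum>n=1..N. ln (real (n ^ 2 ^ \<eta>)))"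
      by (simp add: sum_distrib_left d_def ln_realpow)
    also have "\<dots> \<le> (\<Sum>n=1..N. ln (real (n ^ 2 ^ \<eta> + 1)))"
      by (intro sum_mono ln_mono) auto
    also have "\<dots> = (\<Sum>p\<in>V. v p)" unfolding v_def V_def by (rule sum_ln_values_eq)
    also have "\<dots> = (\<Sum>p | p \<in> V \<and> p \<le> 2 * N. v p) + (\<Sum>p | p \<in> V \<and> \<not> p \<le> 2 * N. v p)"
      by (rule sum.Int_Diff[OF V(1), where B = "{..2 * N}", unfolded Int_def Diff_iff set_diff_eq mem_Collect_eq atMost_iff])
    also have "\<dots> \<le> (real N * ln (real N) + C0 * real N) + K * (\<Sum>p\<in>V. ln (real p))"
    proof (rule add_mono)
      show "(\<Sum>p | p \<in> V \<and> p \<le> 2 * N. v p) \<le> real N * ln (real N) + C0 * real N"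
        unfolding v_def V_def by (rule C0[OF N])
      have "(\<Sum>p | p \<in> V \<and> \<not> p \<le> 2 * N. v p) \<le> (\<Sum>p | p \<in> V \<and> \<not> p \<le> 2 * N. K * ln (real p))"
      proof (rule sum_mono)
        fix p assume p: "p \<in> {p. p \<in> V \<and> \<not> p \<le> 2 * N}"
        then have "(\<Sum>n=1..N. multiplicity p (n ^ 2 ^ \<eta> + 1)) \<le> \<eta> * 2 ^ (\<eta> - 1)"
          using V(2) by (intro sum_multiplicity_large_prime_le) auto
        then have "real (\<Sum>n=1..N. multiplicity p (n ^ 2 ^ \<eta> + 1)) \<le> real (\<eta> * 2 ^ (\<eta> - 1))"
          by (rule of_nat_mono)
        then have "real (\<Sum>n=1..N. multiplicity p (n ^ 2 ^ \<eta> + 1)) \<le> K" by (simp add: K_def)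
        then show "v p \<le> K * ln (real p)"
          unfolding v_def by (rule mult_right_mono) (rule ln_nonneg, use p in simp)
      qed
      \<comment> \<open>The small primes are put back, at no loss for an upper bound, so that the
        sum becomes the logarithm of the radical.\<close>
      also have "\<dots> \<le> (\<Sum>p\<in>V. K * ln (real p))"
      proof (rule sum_mono2)
        show "0 \<le> K * ln (real p)" if "p \<in> V - {p. p \<in> V \<and> \<not> p \<le> 2 * N}" for p
          using ln_nonneg[of p] that K by (intro mult_nonneg_nonneg) auto
      qed (use V(1) in auto)
      finally show "(\<Sum>p | p \<in> V \<and> \<not> p \<le> 2 * N. v p) \<le> K * (\<Sum>p\<in>V. ln (real p))"
        by (simp add: sum_distrib_left)
    qed
    also have "(\<Sum>p\<in>V. ln (real p)) = ln (real_of_int (ell f N))"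
      unfolding V_def assms(2) by (rule ln_ell_eq[symmetric])
    \<comment> \<open>Moving the small-prime term N ln N to the other side lowers the coefficient
      from d to d - 1.\<close>
    finally have "(d - 1) * real N * ln (real N) - (C0 + d) * real N \<le> K * ln (real_of_int (ell f N))"
      by (simp add: algebra_simps)
    moreover have "C0 * real N \<le> \<bar>C0\<bar> * real N" by (intro mult_right_mono) auto
    ultimately have "(d - 1) * real N * ln (real N) - (\<bar>C0\<bar> + d) * real N \<le> K * ln (real_of_int (ell f N))"
      by (simp add: algebra_simps)
    then have "((d - 1) * real N * ln (real N) - (\<bar>C0\<bar> + d) * real N) / K \<le> ln (real_of_int (ell f N))"
      using K by (simp add: divide_le_eq mult.commute)
    also have "((d - 1) * real N * ln (real N) - (\<bar>C0\<bar> + d) * real N) / K =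
        (d - 1) / K * real N * ln (real N) - C * real N"
      using K by (simp add: C_def field_simps)
    finally show ?thesis .
  qed
  ultimately show ?thesis unfolding d_def K_def by (intro exI[of _ C] conjI allI impI)
qed

end
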